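(* Let $\mathbf{X}_1,\dots,\mathbf{X}_n$ be i.i.d. random vectors in $\mathbb{R}^p$ with mean $\boldsymbol{\mu}$, covariance matrix $\boldsymbol{\Sigma}$ and precision matrix $\boldsymbol{\Omega}=\boldsymbol{\Sigma}^{-1}$. Assume (A1) $\boldsymbol{\Omega}\in\mathcal{U}_q(s_p,M_p)$ for a given $q\in[0,1)$, where $s_pM_p^{1-2q}=o\big((n/\log p)^{\frac12-\frac q2}\big)$; (A4) $\log p=o(n)$ and there exists a number $K>0$ such that $\mathbf{E}(X_i-\mu_i)^4\le K$ for all $1\le i\le p$. Let $\widehat{\boldsymbol{\Sigma}}_2$ be the projected Huber-type covariance estimator with truncation level $H=K'(n/\log p)^{1/2}$, where $K'>0$ is a given constant, and let $\tilde{\boldsymbol{\Omega}}_2$ be the symmetrized SCIO estimator obtained by plugging in $\widehat{\boldsymbol{\Sigma}}_2$ with tuning parameter $\lambda=C_0M_p\sqrt{\log p/n}$, where $C_0$ is a sufficiently large constant. Then there exist sufficiently large constants $C_1,C_2$ such that $$\|\tilde{\boldsymbol{\Omega}}_2-\boldsymbol{\Omega}\|_\infty\le C_1M_p^2\sqrt{\frac{\log p}{n}},\qquad \|\tilde{\boldsymbol{\Omega}}_2-\boldsymbol{\Omega}\|_{L_1}\le C_2\,s_pM_p^{2-2q}\Big(\frac{\log p}{n}\Big)^{\frac12(1-q)},$$ with probability greater than $1-O(p^{-\tau})$ for some constant $\tau>0$.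
   Context: Asymptotics are as $n\to\infty$ with $p=p_n$ (and $s_p,M_p$) possibly growing; $a_n=O(b_n)$ means $|a_n|\le C|b_n|$ for some constant $C$ and all large $n$, and $a_n=o(b_n)$ means $a_n/b_n\to0$. $X_i,\mu_i$ denote the $i$th coordinates of a generic sample vector and of its mean, and $\mathbf{X}_{ki}$ is the $i$th coordinate of $\mathbf{X}_k$. Huber-type estimator: let $\psi_H(x)=\min\{H,\max(-H,x)\}$. The mean estimator $\tilde\mu_i$ satisfies $\sum_{k=1}^n\psi_H(\mathbf{X}_{ki}-\tilde\mu_i)=0$, and $\tilde\sigma_{ij}$ satisfies $\sum_{k=1}^n\psi_H\big(\mathbf{X}_{ki}\mathbf{X}_{kj}-(\tilde\sigma_{ij}+\tilde\mu_i\tilde\mu_j)\big)=0$. Put $\tilde{\boldsymbol{\Sigma}}=(\tilde\sigma_{ij})_{p\times p}$ and $$\widehat{\boldsymbol{\Sigma}}_2=\operatorname*{arg\,min}_{\mathbf{S}\succeq\varepsilon\mathbf{I}}\|\mathbf{S}-\tilde{\boldsymbol{\Sigma}}\|_\infty,$$ where the minimum is over symmetric matrices $\mathbf{S}$ with $\mathbf{S}-\varepsilon\mathbf{I}$ positive semidefinite, and $\varepsilon$ is a small (i.e. sufficiently small) positive number. For a vector $\mathbf{a}$: $|\mathbf{a}|_1=\sum_i|a_i|$. For a matrix $\mathbf{A}=(a_{ij})$: $\|\mathbf{A}\|_\infty=\max_{i,j}|a_{ij}|$ and $\|\mathbf{A}\|_{L_1}=\max_j\sum_i|a_{ij}|$.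 For $0\le q<1$, $$\mathcal{U}_q(s_p,M_p)=\Big\{\boldsymbol{\Omega}=(\omega_{ij})_{p\times p}:\ \boldsymbol{\Omega}\succ 0,\ \max_{1\le j\le p}\sum_{i=1}^p|\omega_{ij}|^q\le s_p,\ \|\boldsymbol{\Omega}\|_{L_1}\le M_p\Big\},$$ with $\boldsymbol{\Omega}\succ0$ meaning symmetric positive definite and, for $q=0$, $|x|^0=1$ if $x\neq0$, $|0|^0=0$. SCIO estimator computed from $\widehat{\boldsymbol{\Sigma}}$ with parameter $\lambda$: for $i=1,\dots,p$ let $\boldsymbol{e}_i$ be the $i$th column of the identity matrix and let $$\widehat{\boldsymbol{\beta}}_i\in\operatorname*{arg\,min}_{\boldsymbol{\beta}\in\mathbb{R}^p}\Big\{\tfrac12\boldsymbol{\beta}^{T}\widehat{\boldsymbol{\Sigma}}\boldsymbol{\beta}-\boldsymbol{e}_i^{T}\boldsymbol{\beta}+\lambda|\boldsymbol{\beta}|_1\Big\};$$ put $\widehat{\boldsymbol{\Omega}}=(\widehat{\boldsymbol{\beta}}_1,\dots,\widehat{\boldsymbol{\beta}}_p)$ with entries $\hat\beta_{ij}$. The symmetrized SCIO estimator $\tilde{\boldsymbol{\Omega}}=(\tilde\omega_{ij})$ is defined by $\tilde\omega_{ij}=\tilde\omega_{ji}=\hat\beta_{ij}$ if $|\hat\beta_{ij}|\le|\hat\beta_{ji}|$, and $=\hat\beta_{ji}$ otherwise (when $|\hat\beta_{ij}|=|\hat\beta_{ji}|$, one of the two values is chosen and used for both entries).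
   Formalization: The formal version additionally assumes that the means μ_i are bounded uniformly in n and i (the claim fails for rapidly growing means, as the Huber covariance estimator truncates uncentred products), and "ε sufficiently small" is read with a threshold that may depend on n. *)

theory Defs
  imports "HOL-Probability.Probability" "Jordan_Normal_Form.Matrix"
begin

text \<open>
  The dimension \<open>p\<close> varies with the sample size, so real matrices and vectors are the
  dimension-carrying ones of \<open>Jordan_Normal_Form\<close>. Indices and sample numbers start at 0:
  \<open>X k i \<omega>\<close> is coordinate \<open>i < p\<close> of observation \<open>k < n\<close> at the outcome \<open>\<omega>\<close>.
\<close>

definition max_norm :: "real mat \<Rightarrow> real" where
  "max_norm A = Max (abs ` elements_mat A)"

definition L1_norm :: "real mat \<Rightarrow> real" where
  "L1_norm A = Max ((\<lambda>j. \<Sum>i<dim_row A. \<bar>A $$ (i, j)\<bar>) ` {..<dim_col A})"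

definition sym_posdef :: "nat \<Rightarrow> real mat \<Rightarrow> bool" where
  "sym_posdef p A \<longleftrightarrow> A \<in> carrier_mat p p \<and> transpose_mat A = A \<and>
     (\<forall>v \<in> carrier_vec p. v \<noteq> 0\<^sub>v p \<longrightarrow> 0 < v \<bullet> (A *\<^sub>v v))"

definition sym_possemidef :: "nat \<Rightarrow> real mat \<Rightarrow> bool" where
  "sym_possemidef p A \<longleftrightarrow> A \<in> carrier_mat p p \<and> transpose_mat A = A \<and>
     (\<forall>v \<in> carrier_vec p. 0 \<le> v \<bullet> (A *\<^sub>v v))"

text \<open>
  For \<open>q = 0\<close> the summand \<open>\<bar>x\<bar> powr 0\<close> is 1 if \<open>x \<noteq> 0\<close> and 0 if \<open>x = 0\<close>, because
  \<open>0 powr a = 0\<close> for every \<open>a\<close>; so the column sums count the nonzero entries.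
\<close>
definition sparse_class :: "nat \<Rightarrow> real \<Rightarrow> real \<Rightarrow> real \<Rightarrow> real mat set" where
  "sparse_class p q s M = {W. sym_posdef p W \<and>
     (\<forall>j<p. (\<Sum>i<p. \<bar>W $$ (i, j)\<bar> powr q) \<le> s) \<and> L1_norm W \<le> M}"

definition iid_vectors :: "'w measure \<Rightarrow> nat \<Rightarrow> nat \<Rightarrow> (nat \<Rightarrow> nat \<Rightarrow> 'w \<Rightarrow> real) \<Rightarrow> bool" where
  "iid_vectors P n p X \<longleftrightarrow>
     (let V = (\<lambda>k \<omega>. \<lambda>i\<in>{..<p}. X k i \<omega>); R = (\<Pi>\<^sub>M i\<in>{..<p}. (borel :: real measure))
      in prob_space.indep_vars P (\<lambda>_. R) V {..<n} \<and>
         (\<forall>k<n. \<forall>l<n. distr P R (V k) = distr P R (V l)))"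

text \<open>
  The estimators below are relations between a data array \<open>x\<close> (entry \<open>x k i\<close>) and a possible
  value of the estimator, since the Huber equations, the projection and the symmetrization need
  not determine a unique value.
\<close>

definition huber_psi :: "real \<Rightarrow> real \<Rightarrow> real" where
  "huber_psi H x = min H (max (- H) x)"

definition huber_mean :: "nat \<Rightarrow> nat \<Rightarrow> real \<Rightarrow> (nat \<Rightarrow> nat \<Rightarrow> real) \<Rightarrow> real vec \<Rightarrow> bool" where
  "huber_mean n p H x m \<longleftrightarrow> m \<in> carrier_vec p \<and>
     (\<forall>i<p. (\<Sum>k<n. huber_psi H (x k i - m $ i)) = 0)"

definition huber_cov ::
  "nat \<Rightarrow> nat \<Rightarrow> real \<Rightarrow> (nat \<Rightarrow> nat \<Rightarrow> real) \<Rightarrow> real vec \<Rightarrow> real mat \<Rightarrow> bool" where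
  "huber_cov n p H x m S \<longleftrightarrow> S \<in> carrier_mat p p \<and>
     (\<forall>i<p. \<forall>j<p.
        (\<Sum>k<n. huber_psi H (x k i * x k j - (S $$ (i, j) + m $ i * m $ j))) = 0)"

definition psd_projection :: "nat \<Rightarrow> real \<Rightarrow> real mat \<Rightarrow> real mat \<Rightarrow> bool" where
  "psd_projection p \<epsilon> S0 S \<longleftrightarrow>
     is_arg_min (\<lambda>S. max_norm (S - S0))
       (\<lambda>S. S \<in> carrier_mat p p \<and> sym_possemidef p (S - \<epsilon> \<cdot>\<^sub>m 1\<^sub>m p)) S"

definition scio :: "nat \<Rightarrow> real \<Rightarrow> real mat \<Rightarrow> real mat \<Rightarrow> bool" where
  "scio p lam S B \<longleftrightarrow> B \<in> carrier_mat p p \<and>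
     (\<forall>i<p. is_arg_min
        (\<lambda>b. 1 / 2 * (b \<bullet> (S *\<^sub>v b)) - unit_vec p i \<bullet> b + lam * (\<Sum>j<p. \<bar>b $ j\<bar>))
        (\<lambda>b. b \<in> carrier_vec p) (col B i))"

definition symmetrization :: "nat \<Rightarrow> real mat \<Rightarrow> real mat \<Rightarrow> bool" where
  "symmetrization p B W \<longleftrightarrow> W \<in> carrier_mat p p \<and>
     (\<forall>i<p. \<forall>j<p. W $$ (i, j) = W $$ (j, i) \<and>
        W $$ (i, j) \<in> {B $$ (i, j), B $$ (j, i)} \<and>
        (\<bar>B $$ (i, j)\<bar> < \<bar>B $$ (j, i)\<bar> \<longrightarrow> W $$ (i, j) = B $$ (i, j)))"

definition huber_scio ::
  "nat \<Rightarrow> nat \<Rightarrow> real \<Rightarrow> real \<Rightarrow> real \<Rightarrow> (nat \<Rightarrow> nat \<Rightarrow> real) \<Rightarrow> real mat \<Rightarrow> bool" where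
  "huber_scio n p H \<epsilon> lam x W \<longleftrightarrow>
     (\<exists>m S0 S B. huber_mean n p H x m \<and> huber_cov n p H x m S0 \<and>
        psd_projection p \<epsilon> S0 S \<and> scio p lam S B \<and> symmetrization p B W)"

end

theory Submission
  imports Defs
begin

text \<open>
  With \<open>a = sqrt (ln p / n)\<close> the truncation level is \<open>H = K' / a\<close>. Since
  \<open>exp (huber_psi H x / H) \<le> 1 + x / H + (x / H)\<^sup>2\<close>, an exponential Markov inequality needing only
  second moments shows that every root of a Huber equation is within \<open>c a\<close> of the true mean, up to
  probability \<open>2 / p ^ 3\<close>; for the products of coordinates the second moments come from (A4).
  Hence all entries of the pilot covariance matrix are within \<open>O(a)\<close> of \<open>\<Sigma>\<close>. As \<open>\<Sigma>\<close> is feasible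
  for \<open>\<epsilon> \<le> 1 / M\<close>, the projection at most doubles this error.

  The rest is deterministic. For a SCIO column \<open>\<beta>\<close> and \<open>h = \<beta> - \<omega>\<close>, optimality gives
  \<open>\<bar>S \<beta> - e\<bar> \<le> \<lambda>\<close> entrywise and \<open>\<bar>\<beta>\<bar>\<^sub>1 \<le> \<bar>\<omega>\<bar>\<^sub>1 + \<bar>h\<bar>\<^sub>1 / 3\<close>, so \<open>\<bar>h\<bar>\<^sub>1 \<le> 3 M\<close>, and multiplying the bound on
  \<open>\<Sigma> h\<close> by \<open>\<Omega>\<close> gives the entrywise rate \<open>t = O(M \<lambda>)\<close>. The \<open>L1\<close> rate follows from
  \<open>\<Sum> min t \<bar>\<omega>\<bar> \<le> s t powr (1 - q)\<close>.
\<close>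

text \<open>\<open>$\<close> and \<open>\<bullet>\<close> also denote operations of \<open>HOL-Analysis\<close>; the parse trees of long sums
  would otherwise multiply.\<close>
unbundle no vec_syntax and no inner_syntax

section \<open>Matrix norms and quadratic forms\<close>

lemma abs_scalar_prod_le:
  fixes u v :: "real vec"
  assumes "u \<in> carrier_vec p" "v \<in> carrier_vec p" "\<And>k. k < p \<Longrightarrow> \<bar>v $ k\<bar> \<le> d"
  shows "\<bar>u \<bullet> v\<bar> \<le> d * (\<Sum>k<p. \<bar>u $ k\<bar>)"
proof -
  have "\<bar>u \<bullet> v\<bar> = \<bar>\<Sum>k<p. u $ k * v $ k\<bar>"
    using assms by (simp add: scalar_prod_def atLeast0LessThan)
  also have "\<dots> \<le> (\<Sum>k<p. \<bar>u $ k * v $ k\<bar>)" by (rule sum_abs)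
  also have "\<dots> \<le> (\<Sum>k<p. d * \<bar>u $ k\<bar>)"
    using assms(3) by (intro sum_mono) (auto simp: abs_mult mult.commute[of d] intro: mult_left_mono)
  finally show ?thesis by (simp add: sum_distrib_left)
qed

lemma abs_mult_mat_vec_le:
  fixes A :: "real mat" and v :: "real vec"
  assumes "A \<in> carrier_mat p p" "v \<in> carrier_vec p" "k < p"
    and "\<And>j. j < p \<Longrightarrow> \<bar>A $$ (k, j)\<bar> \<le> d"
  shows "\<bar>(A *\<^sub>v v) $ k\<bar> \<le> d * (\<Sum>j<p. \<bar>v $ j\<bar>)"
proof -
  have "(A *\<^sub>v v) $ k = v \<bullet> row A k"
    using assms by (simp add: comm_scalar_prod[of _ p])
  then show ?thesis
    using abs_scalar_prod_le[of v p "row A k" d] assms by simp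
qed

lemma max_norm_le_iff:
  assumes "A \<in> carrier_mat p p" "p \<ge> 1"
  shows "max_norm A \<le> d \<longleftrightarrow> (\<forall>i<p. \<forall>j<p. \<bar>A $$ (i, j)\<bar> \<le> d)"
proof -
  have "finite (elements_mat A)" by (simp add: elements_mat_def)
  moreover have "A $$ (0, 0) \<in> elements_mat A" using assms by (intro elements_matI) auto
  ultimately have "max_norm A \<le> d \<longleftrightarrow> (\<forall>x \<in> elements_mat A. \<bar>x\<bar> \<le> d)"
    unfolding max_norm_def by (subst Max_le_iff) auto
  then show ?thesis
    using assms(1) by (auto intro: elements_matI dest!: elements_matD)
qed

lemma L1_norm_le_iff:
  assumes "A \<in> carrier_mat p p" "p \<ge> 1"
  shows "L1_norm A \<le> d \<longleftrightarrow> (\<forall>j<p. (\<Sum>i<p. \<bar>A $$ (i, j)\<bar>) \<le> d)"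
  using assms unfolding L1_norm_def by (subst Max_le_iff) (auto simp: lessThan_empty_iff)

lemma symmetric_index:
  assumes "A \<in> carrier_mat p p" "transpose_mat A = A" "i < p" "j < p"
  shows "A $$ (i, j) = A $$ (j, i)"
  using assms by (metis carrier_matD index_transpose_mat(1))

lemma symmetric_scalar_prod_mult_mat_vec:
  fixes A :: "real mat"
  assumes "A \<in> carrier_mat p p" "transpose_mat A = A" "u \<in> carrier_vec p" "v \<in> carrier_vec p"
  shows "u \<bullet> (A *\<^sub>v v) = v \<bullet> (A *\<^sub>v u)"
  using transpose_vec_mult_scalar[of A p p v u] assms
  by (simp add: comm_scalar_prod[of _ p])

text \<open>Symmetry of \<open>S\<close> merges the two cross terms, so the Taylor expansion at
  \<open>b\<close> is exact with gradient \<open>S *\<^sub>v b - e\<close>. It is used at the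
  minimizer for the optimality conditions and at the true column for the comparison of
  objectives.\<close>

lemma quadratic_expansion:
  fixes S :: "real mat"
  assumes S: "S \<in> carrier_mat p p" "transpose_mat S = S"
    and "b \<in> carrier_vec p" "h \<in> carrier_vec p" "e \<in> carrier_vec p"
  shows "1 / 2 * ((b + h) \<bullet> (S *\<^sub>v (b + h))) - e \<bullet> (b + h) =
    1 / 2 * (b \<bullet> (S *\<^sub>v b)) - e \<bullet> b + h \<bullet> (S *\<^sub>v b - e) + 1 / 2 * (h \<bullet> (S *\<^sub>v h))"
proof -
  have c: "S *\<^sub>v b \<in> carrier_vec p" "S *\<^sub>v h \<in> carrier_vec p"
    using assms by auto
  show ?thesis
    using assms c symmetric_scalar_prod_mult_mat_vec[OF S, of b h]
    by (simp add: mult_add_distrib_mat_vec[of _ p p] add_scalar_prod_distrib[of _ p]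
        scalar_prod_add_distrib[of _ p] scalar_prod_minus_distrib[of _ p] comm_scalar_prod[of h p e])
qed

text \<open>For a symmetric matrix the column sums bound the largest eigenvalue: each product of
  coordinates splits into two half squares, and by symmetry both halves collect the same column
  sums.\<close>

lemma quadratic_form_le_L1:
  fixes W :: "real mat"
  assumes W: "W \<in> carrier_mat p p" "transpose_mat W = W" and v: "v \<in> carrier_vec p"
    and M: "\<And>j. j < p \<Longrightarrow> (\<Sum>i<p. \<bar>W $$ (i, j)\<bar>) \<le> M"
  shows "v \<bullet> (W *\<^sub>v v) \<le> M * (v \<bullet> v)"
proof -
  have "v \<bullet> (W *\<^sub>v v) = (\<Sum>i<p. \<Sum>j<p. W $$ (i, j) * (v $ i * v $ j))"
    using W v by (simp add: scalar_prod_def atLeast0LessThan sum_distrib_left mult_ac)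
  also have "\<dots> \<le> (\<Sum>i<p. \<Sum>j<p. \<bar>W $$ (i, j)\<bar> * ((v $ i)\<^sup>2 / 2 + (v $ j)\<^sup>2 / 2))"
  proof (intro sum_mono)
    fix i j
    have "\<bar>v $ i * v $ j\<bar> \<le> (v $ i)\<^sup>2 / 2 + (v $ j)\<^sup>2 / 2"
      using sum_squares_bound[of "\<bar>v $ i\<bar>" "\<bar>v $ j\<bar>"] by (simp add: abs_mult)
    then have "\<bar>W $$ (i, j)\<bar> * \<bar>v $ i * v $ j\<bar> \<le> \<bar>W $$ (i, j)\<bar> * ((v $ i)\<^sup>2 / 2 + (v $ j)\<^sup>2 / 2)"
      by (intro mult_left_mono) auto
    then show "W $$ (i, j) * (v $ i * v $ j) \<le> \<bar>W $$ (i, j)\<bar> * ((v $ i)\<^sup>2 / 2 + (v $ j)\<^sup>2 / 2)"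
      using abs_ge_self[of "W $$ (i, j) * (v $ i * v $ j)"]
      unfolding abs_mult[of "W $$ (i, j)"] by linarith
  qed
  also have "\<dots> = (\<Sum>i<p. \<Sum>j<p. \<bar>W $$ (i, j)\<bar> * ((v $ i)\<^sup>2 / 2))
      + (\<Sum>i<p. \<Sum>j<p. \<bar>W $$ (i, j)\<bar> * ((v $ j)\<^sup>2 / 2))"
    by (simp only: distrib_left sum.distrib)
  also have "(\<Sum>i<p. \<Sum>j<p. \<bar>W $$ (i, j)\<bar> * ((v $ i)\<^sup>2 / 2))
      = (\<Sum>i<p. \<Sum>j<p. \<bar>W $$ (j, i)\<bar> * ((v $ i)\<^sup>2 / 2))"
    by (intro sum.cong refl) (simp add: symmetric_index[OF W])
  also have "(\<Sum>i<p. \<Sum>j<p. \<bar>W $$ (i, j)\<bar> * ((v $ j)\<^sup>2 / 2))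
      = (\<Sum>i<p. \<Sum>j<p. \<bar>W $$ (j, i)\<bar> * ((v $ i)\<^sup>2 / 2))"
    by (rule sum.swap)
  also have "(\<Sum>i<p. \<Sum>j<p. \<bar>W $$ (j, i)\<bar> * ((v $ i)\<^sup>2 / 2))
      + (\<Sum>i<p. \<Sum>j<p. \<bar>W $$ (j, i)\<bar> * ((v $ i)\<^sup>2 / 2))
      = (\<Sum>i<p. (\<Sum>j<p. \<bar>W $$ (j, i)\<bar>) * (v $ i)\<^sup>2)"
    by (simp add: sum_distrib_right flip: sum.distrib)
  also have "\<dots> \<le> (\<Sum>i<p. M * (v $ i)\<^sup>2)"
    using M by (intro sum_mono mult_right_mono) auto
  also have "\<dots> = M * (v \<bullet> v)"
    using v by (simp add: scalar_prod_def atLeast0LessThan power2_eq_square sum_distrib_left)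
  finally show ?thesis .
qed

lemma inverse_symmetric:
  fixes A W :: "real mat"
  assumes A: "A \<in> carrier_mat p p" and W: "W \<in> carrier_mat p p" "transpose_mat W = W"
    and inv: "A * W = 1\<^sub>m p" "W * A = 1\<^sub>m p"
  shows "transpose_mat A = A"
proof -
  have "transpose_mat A * W = 1\<^sub>m p"
    using arg_cong[OF inv(2), of transpose_mat] A W by (simp add: transpose_mult[of _ p p])
  then have "transpose_mat A * W * A = A" using A by simp
  then show ?thesis
    using A W inv(2) assoc_mult_mat[of "transpose_mat A" p p W p A p] by simp
qed

text \<open>With \<open>u = A v\<close>, so that \<open>v = W u\<close>, the claim is nonnegativity of the form of \<open>W\<close>
  at \<open>M u - v\<close>.\<close>
lemma inverse_quadratic_ge:
  fixes A W :: "real mat"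
  assumes A: "A \<in> carrier_mat p p" and W: "W \<in> carrier_mat p p" "transpose_mat W = W"
    and pos: "\<And>x. x \<in> carrier_vec p \<Longrightarrow> 0 \<le> x \<bullet> (W *\<^sub>v x)"
    and inv: "A * W = 1\<^sub>m p" "W * A = 1\<^sub>m p"
    and M: "M > 0" "\<And>j. j < p \<Longrightarrow> (\<Sum>i<p. \<bar>W $$ (i, j)\<bar>) \<le> M"
    and v: "v \<in> carrier_vec p"
  shows "v \<bullet> v \<le> M * (v \<bullet> (A *\<^sub>v v))"
proof -
  define u where "u = A *\<^sub>v v"
  have u: "u \<in> carrier_vec p" using A v by (simp add: u_def)
  have Wu: "W *\<^sub>v u = v"
    using assoc_mult_mat_vec[OF W(1) A v] inv(2) v by (simp add: u_def)
  have c: "W *\<^sub>v v \<in> carrier_vec p" using W v by simp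
  have "0 \<le> (M \<cdot>\<^sub>v u + - v) \<bullet> (W *\<^sub>v (M \<cdot>\<^sub>v u + - v))"
    using u v by (intro pos) auto
  also have "\<dots> = M\<^sup>2 * (u \<bullet> v) - M * (u \<bullet> (W *\<^sub>v v)) - M * (v \<bullet> v) + v \<bullet> (W *\<^sub>v v)"
  proof -
    have "W *\<^sub>v (- v) = - (W *\<^sub>v v)"
      by (rule eq_vecI) (use W v in auto)
    then have "W *\<^sub>v (M \<cdot>\<^sub>v u + - v) = M \<cdot>\<^sub>v v + - (W *\<^sub>v v)"
      using W u v Wu by (simp add: mult_add_distrib_mat_vec[of _ p p] mult_mat_vec[of _ p p])
    moreover have "- v \<bullet> (W *\<^sub>v v) = - (v \<bullet> (W *\<^sub>v v))"
      using c v by (intro scalar_prod_uminus_left) (simp only: carrier_vecD)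
    moreover have "x \<bullet> - (W *\<^sub>v v) = - (x \<bullet> (W *\<^sub>v v))" if "x \<in> carrier_vec p" for x
      using c that by (intro scalar_prod_uminus_right) (simp only: carrier_vecD)
    ultimately show ?thesis
      using u v c
      by (simp add: scalar_prod_uminus_left add_scalar_prod_distrib[of _ p] scalar_prod_add_distrib[of _ p]
          power2_eq_square algebra_simps)
  qed
  also have "u \<bullet> (W *\<^sub>v v) = v \<bullet> v"
    using symmetric_scalar_prod_mult_mat_vec[OF W u v] Wu by simp
  also have "v \<bullet> (W *\<^sub>v v) \<le> M * (v \<bullet> v)"
    by (rule quadratic_form_le_L1[OF W v M(2)])
  \<comment> \<open>One of the two subtracted multiples of \<open>v \<bullet> v\<close> is used up
    by the bound on the form of \<open>W\<close> at \<open>v\<close>; the other remains.\<close>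
  finally have "M * (v \<bullet> v) \<le> M * (M * (u \<bullet> v))"
    by (simp add: power2_eq_square)
  then have "v \<bullet> v \<le> M * (u \<bullet> v)" using M(1) by simp
  then show ?thesis using u v by (simp add: u_def comm_scalar_prod[of _ p])
qed

section \<open>The SCIO estimator\<close>

lemma scio_minimal:
  assumes "scio p lam S B" "i < p" "b \<in> carrier_vec p"
  shows "1 / 2 * (col B i \<bullet> (S *\<^sub>v col B i)) - unit_vec p i \<bullet> col B i
      + lam * (\<Sum>j<p. \<bar>col B i $ j\<bar>) \<le>
    1 / 2 * (b \<bullet> (S *\<^sub>v b)) - unit_vec p i \<bullet> b + lam * (\<Sum>j<p. \<bar>b $ j\<bar>)"
  using assms unfolding scio_def is_arg_min_def not_less[symmetric] by blast

lemma scio_perturbation: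
  fixes S :: "real mat" and b h :: "real vec"
  assumes S: "S \<in> carrier_mat p p" "transpose_mat S = S"
    and scio: "scio p lam S B" and i: "i < p" and h: "h \<in> carrier_vec p"
  shows "0 \<le> h \<bullet> (S *\<^sub>v col B i - unit_vec p i) + 1 / 2 * (h \<bullet> (S *\<^sub>v h)) +
    lam * ((\<Sum>j<p. \<bar>(col B i + h) $ j\<bar>) - (\<Sum>j<p. \<bar>col B i $ j\<bar>))"
proof -
  let ?b = "col B i"
  have b: "?b \<in> carrier_vec p" using scio i by (auto simp: scio_def)
  have "1 / 2 * (?b \<bullet> (S *\<^sub>v ?b)) - unit_vec p i \<bullet> ?b + lam * (\<Sum>j<p. \<bar>?b $ j\<bar>) \<le>
      1 / 2 * ((?b + h) \<bullet> (S *\<^sub>v (?b + h))) - unit_vec p i \<bullet> (?b + h) +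
      lam * (\<Sum>j<p. \<bar>(?b + h) $ j\<bar>)"
    using b h by (intro scio_minimal[OF scio i]) simp
  then show ?thesis
    using quadratic_expansion[OF S b h, of "unit_vec p i"]
    by (simp add: right_diff_distrib)
qed

text \<open>If a gradient coordinate exceeded \<open>lam\<close>, a small step against its sign
  along that axis would gain more at first order than the penalty costs, contradicting
  minimality.\<close>

lemma scio_kkt:
  fixes S :: "real mat"
  assumes S: "S \<in> carrier_mat p p" "transpose_mat S = S"
    and scio: "scio p lam S B" and lam: "lam \<ge> 0" and i: "i < p" and k: "k < p"
  shows "\<bar>(S *\<^sub>v col B i - unit_vec p i) $ k\<bar> \<le> lam"
proof (rule ccontr)
  let ?b = "col B i"
  define g where "g = S *\<^sub>v ?b - unit_vec p i"
  assume "\<not> ?thesis"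
  then have gt: "lam < \<bar>g $ k\<bar>" by (simp add: g_def)
  have b: "?b \<in> carrier_vec p" using scio i by (auto simp: scio_def)
  have g: "g \<in> carrier_vec p" using S b by (simp add: g_def)
  define c where "c = S $$ (k, k)"
  have ineq: "0 \<le> t * g $ k + t\<^sup>2 / 2 * c + lam * \<bar>t\<bar>" for t
  proof -
    define h where "h = t \<cdot>\<^sub>v unit_vec p k"
    have h: "h \<in> carrier_vec p" by (simp add: h_def)
    have "h \<bullet> g = t * g $ k"
      using g k by (simp add: h_def)
    moreover have "h \<bullet> (S *\<^sub>v h) = t\<^sup>2 * c"
    proof -
      have "S *\<^sub>v h = t \<cdot>\<^sub>v (S *\<^sub>v unit_vec p k)"
        using S by (simp add: h_def mult_mat_vec[of _ p p])
      then show ?thesis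
        using S k by (simp add: h_def c_def power2_eq_square)
    qed
    moreover have "(\<Sum>j<p. \<bar>(?b + h) $ j\<bar>) \<le> (\<Sum>j<p. \<bar>?b $ j\<bar>) + \<bar>t\<bar>"
    proof -
      have "(\<Sum>j<p. \<bar>(?b + h) $ j\<bar>) \<le> (\<Sum>j<p. \<bar>?b $ j\<bar> + (if j = k then \<bar>t\<bar> else 0))"
        using h b k by (intro sum_mono) (auto simp: h_def unit_vec_def)
      then show ?thesis using k by (simp add: sum.distrib)
    qed
    then have "lam * ((\<Sum>j<p. \<bar>(?b + h) $ j\<bar>) - (\<Sum>j<p. \<bar>?b $ j\<bar>)) \<le> lam * \<bar>t\<bar>"
      using lam by (intro mult_left_mono) auto
    ultimately show ?thesis
      using scio_perturbation[OF S scio i h] by (simp add: g_def)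
  qed
  define a where "a = \<bar>g $ k\<bar> - lam"
  \<comment> \<open>This step length keeps the quadratic term below the linear gain
    \<open>r * a\<close>. The \<open>+ 1\<close> covers a zero diagonal entry.\<close>
  define r where "r = a / (\<bar>c\<bar> + 1)"
  have a: "a > 0" using gt by (simp add: a_def)
  then have r: "r > 0" by (simp add: r_def)
  have "0 \<le> (- sgn (g $ k) * r) * g $ k + (- sgn (g $ k) * r)\<^sup>2 / 2 * c + lam * \<bar>- sgn (g $ k) * r\<bar>"
    by (rule ineq)
  moreover have "(- sgn (g $ k) * r) * g $ k = - r * \<bar>g $ k\<bar>"
    by (simp add: sgn_if abs_if)
  moreover have "(sgn (g $ k))\<^sup>2 = 1" "\<bar>sgn (g $ k)\<bar> = 1"
    using gt lam by (auto simp: sgn_if)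
  ultimately have "r * a \<le> r * (r / 2 * c)"
    using r by (simp add: a_def power2_eq_square power_mult_distrib abs_mult algebra_simps)
  then have "a \<le> r / 2 * c" using r by simp
  also have "\<dots> \<le> r * \<bar>c\<bar>"
  proof -
    have "r * (c / 2) \<le> r * \<bar>c\<bar>" using r by (intro mult_left_mono) auto
    then show ?thesis by simp
  qed
  also have "\<dots> < r * (\<bar>c\<bar> + 1)" using r by simp
  also have "\<dots> = a" by (simp add: r_def)
  finally show False by simp
qed

text \<open>The objective at the minimizer is compared with that at \<open>w\<close>.
  Semidefiniteness discards the quadratic term, and the residual of at most \<open>lam / 3\<close>
  makes the linear term cost a third of the l1 distance.\<close>

lemma scio_basic_inequality:
  fixes S :: "real mat"
  assumes S: "S \<in> carrier_mat p p" "transpose_mat S = S"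
    and psd: "\<And>v. v \<in> carrier_vec p \<Longrightarrow> 0 \<le> v \<bullet> (S *\<^sub>v v)"
    and scio: "scio p lam S B" and lam: "lam > 0" and i: "i < p" and w: "w \<in> carrier_vec p"
    and res: "\<And>k. k < p \<Longrightarrow> \<bar>(S *\<^sub>v w - unit_vec p i) $ k\<bar> \<le> lam / 3"
  shows "(\<Sum>j<p. \<bar>col B i $ j\<bar>) \<le> (\<Sum>j<p. \<bar>w $ j\<bar>) + 1 / 3 * (\<Sum>j<p. \<bar>col B i $ j - w $ j\<bar>)"
proof -
  let ?b = "col B i" and ?e = "unit_vec p i"
  define h where "h = ?b - w"
  have B: "B \<in> carrier_mat p p" using scio by (simp add: scio_def)
  have b: "?b \<in> carrier_vec p" using B i by simp
  have h: "h \<in> carrier_vec p" using b w by (simp add: h_def)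
  have wh: "w + h = ?b" using B i w unfolding h_def by (intro eq_vecI) auto
  have "1 / 2 * (?b \<bullet> (S *\<^sub>v ?b)) - ?e \<bullet> ?b + lam * (\<Sum>j<p. \<bar>?b $ j\<bar>) \<le>
      1 / 2 * (w \<bullet> (S *\<^sub>v w)) - ?e \<bullet> w + lam * (\<Sum>j<p. \<bar>w $ j\<bar>)"
    by (rule scio_minimal[OF scio i w])
  then have "h \<bullet> (S *\<^sub>v w - ?e) + 1 / 2 * (h \<bullet> (S *\<^sub>v h)) + lam * (\<Sum>j<p. \<bar>?b $ j\<bar>)
      \<le> lam * (\<Sum>j<p. \<bar>w $ j\<bar>)"
    using quadratic_expansion[OF S w h, of ?e] by (simp add: wh)
  moreover have "\<bar>h \<bullet> (S *\<^sub>v w - ?e)\<bar> \<le> lam / 3 * (\<Sum>j<p. \<bar>h $ j\<bar>)"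
    using S w h res by (intro abs_scalar_prod_le) auto
  ultimately have "lam * (\<Sum>j<p. \<bar>?b $ j\<bar>) \<le> lam * (\<Sum>j<p. \<bar>w $ j\<bar>) + lam / 3 * (\<Sum>j<p. \<bar>h $ j\<bar>)"
    using psd[OF h] by linarith
  also have "\<dots> = lam * ((\<Sum>j<p. \<bar>w $ j\<bar>) + 1 / 3 * (\<Sum>j<p. \<bar>h $ j\<bar>))"
    by (simp add: distrib_left)
  finally have "(\<Sum>j<p. \<bar>?b $ j\<bar>) \<le> (\<Sum>j<p. \<bar>w $ j\<bar>) + 1 / 3 * (\<Sum>j<p. \<bar>h $ j\<bar>)"
    using lam by simp
  then show ?thesis using B w i by (simp add: h_def)
qed

text \<open>No eigenvalue bound for \<open>S\<close> enters beyond semidefiniteness: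
  \<open>Sg\<close> times the error is controlled entrywise, and multiplying by \<open>Om\<close>
  costs only its row sums.\<close>

lemma scio_column_bounds:
  fixes S Sg Om :: "real mat"
  assumes Sg: "Sg \<in> carrier_mat p p" and Om: "Om \<in> carrier_mat p p" "transpose_mat Om = Om"
    and inv: "Sg * Om = 1\<^sub>m p" "Om * Sg = 1\<^sub>m p"
    and M: "\<And>j. j < p \<Longrightarrow> (\<Sum>i<p. \<bar>Om $$ (i, j)\<bar>) \<le> M"
    and S: "S \<in> carrier_mat p p" "transpose_mat S = S"
    and psd: "\<And>v. v \<in> carrier_vec p \<Longrightarrow> 0 \<le> v \<bullet> (S *\<^sub>v v)"
    and close: "\<And>i j. i < p \<Longrightarrow> j < p \<Longrightarrow> \<bar>S $$ (i, j) - Sg $$ (i, j)\<bar> \<le> d"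
    and d: "d * M \<le> lam / 3" and lam: "lam > 0"
    and scio: "scio p lam S B" and i: "i < p"
  shows "(\<Sum>j<p. \<bar>B $$ (j, i)\<bar>) \<le>
      (\<Sum>j<p. \<bar>Om $$ (j, i)\<bar>) + 1 / 3 * (\<Sum>j<p. \<bar>B $$ (j, i) - Om $$ (j, i)\<bar>)"
    and "\<And>k. k < p \<Longrightarrow> \<bar>B $$ (k, i) - Om $$ (k, i)\<bar> \<le> 7 / 3 * M * lam"
proof -
  let ?b = "col B i" and ?e = "unit_vec p i" and ?w = "col Om i"
  define h where "h = ?b - ?w"
  have B: "B \<in> carrier_mat p p" using scio by (simp add: scio_def)
  have b: "?b \<in> carrier_vec p" using B i by simp
  have w: "?w \<in> carrier_vec p" using Om(1) i by simp
  have h: "h \<in> carrier_vec p" using b w by (simp add: h_def)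
  have d0: "d \<ge> 0" using close[OF i i] by linarith
  have D: "S - Sg \<in> carrier_mat p p" using Sg by (rule minus_carrier_mat)
  have Dle: "\<bar>((S - Sg) *\<^sub>v v) $ k\<bar> \<le> d * (\<Sum>j<p. \<bar>v $ j\<bar>)" if "k < p" "v \<in> carrier_vec p" for v k
    using abs_mult_mat_vec_le[OF D that(2,1)] close S Sg that by auto
  have Sgw: "Sg *\<^sub>v ?w = ?e"
    using inv(1) Sg Om i by (metis carrier_matD(2) col_mult2 col_one)
  have w1: "(\<Sum>j<p. \<bar>?w $ j\<bar>) \<le> M" using M[OF i] Om i by simp
  have res: "\<bar>(S *\<^sub>v ?w - ?e) $ k\<bar> \<le> lam / 3" if k: "k < p" for k
  proof -
    have "S *\<^sub>v ?w - ?e = (S - Sg) *\<^sub>v ?w"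
      using S Sg w by (simp add: Sgw minus_mult_distrib_mat_vec[of _ p p])
    then have "\<bar>(S *\<^sub>v ?w - ?e) $ k\<bar> \<le> d * (\<Sum>j<p. \<bar>?w $ j\<bar>)"
      using Dle[OF k w] by simp
    also have "\<dots> \<le> d * M" using w1 d0 by (rule mult_left_mono)
    finally show ?thesis using d by simp
  qed
  have cone: "(\<Sum>j<p. \<bar>?b $ j\<bar>) \<le> (\<Sum>j<p. \<bar>?w $ j\<bar>) + 1 / 3 * (\<Sum>j<p. \<bar>?b $ j - ?w $ j\<bar>)"
    by (rule scio_basic_inequality[OF S psd scio lam i w res])
  then show "(\<Sum>j<p. \<bar>B $$ (j, i)\<bar>) \<le>
      (\<Sum>j<p. \<bar>Om $$ (j, i)\<bar>) + 1 / 3 * (\<Sum>j<p. \<bar>B $$ (j, i) - Om $$ (j, i)\<bar>)"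
    using B Om i by simp
  \<comment> \<open>The l1 norm of \<open>h\<close> is at most those of both columns together, hence
    at most \<open>2 * M\<close> plus a third of itself.\<close>
  have h1: "(\<Sum>j<p. \<bar>h $ j\<bar>) \<le> 3 * M"
  proof -
    have "(\<Sum>j<p. \<bar>?b $ j - ?w $ j\<bar>) \<le> (\<Sum>j<p. \<bar>?b $ j\<bar> + \<bar>?w $ j\<bar>)"
      by (intro sum_mono abs_triangle_ineq4)
    then have "(\<Sum>j<p. \<bar>?b $ j - ?w $ j\<bar>) \<le> 3 * M"
      using cone w1 by (simp add: sum.distrib)
    then show ?thesis using B Om i by (simp add: h_def)
  qed
  have sup: "\<bar>(Sg *\<^sub>v h) $ k\<bar> \<le> 7 / 3 * lam" if k: "k < p" for k
  proof -
    \<comment> \<open>The three terms are at most \<open>lam\<close>, \<open>lam / 3\<close> and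
      \<open>d * (3 * M) \<le> lam\<close>, which is the origin of \<open>7 / 3\<close>.\<close>
    have "Sg *\<^sub>v h = (S *\<^sub>v ?b - ?e) - (S *\<^sub>v ?w - ?e) - (S - Sg) *\<^sub>v h"
      using S Sg b w h
      by (intro eq_vecI)
        (auto simp: h_def minus_mult_distrib_mat_vec[of _ p p] mult_minus_distrib_mat_vec[of _ p p])
    moreover have "dim_vec ((S - Sg) *\<^sub>v h) = p" "dim_vec (S *\<^sub>v ?w - ?e) = p"
      using S Sg by auto
    ultimately have "(Sg *\<^sub>v h) $ k = (S *\<^sub>v ?b - ?e) $ k - (S *\<^sub>v ?w - ?e) $ k - ((S - Sg) *\<^sub>v h) $ k"
      using k by (simp only: index_minus_vec)
    moreover have "\<bar>((S - Sg) *\<^sub>v h) $ k\<bar> \<le> lam"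
    proof -
      have "\<bar>((S - Sg) *\<^sub>v h) $ k\<bar> \<le> d * (3 * M)"
        using Dle[OF k h] mult_left_mono[OF h1 d0] by linarith
      then show ?thesis using d by simp
    qed
    moreover have "\<bar>(S *\<^sub>v ?b - ?e) $ k\<bar> \<le> lam"
      using lam by (intro scio_kkt[OF S scio _ i k]) simp
    ultimately show ?thesis using res[OF k] by linarith
  qed
  fix k assume k: "k < p"
  have "Om *\<^sub>v (Sg *\<^sub>v h) = h"
    using assoc_mult_mat_vec[OF Om(1) Sg h] inv(2) h by simp
  then have "h $ k = row Om k \<bullet> (Sg *\<^sub>v h)"
    using Om k by (metis carrier_matD(1) index_mult_mat_vec)
  moreover have "\<bar>row Om k \<bullet> (Sg *\<^sub>v h)\<bar> \<le> 7 / 3 * lam * (\<Sum>j<p. \<bar>row Om k $ j\<bar>)"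
    using Om Sg h k sup by (intro abs_scalar_prod_le) auto
  moreover have "(\<Sum>j<p. \<bar>row Om k $ j\<bar>) \<le> M"
    using M[OF k] Om k symmetric_index[OF Om k] by simp
  then have "7 / 3 * lam * (\<Sum>j<p. \<bar>row Om k $ j\<bar>) \<le> 7 / 3 * lam * M"
    using lam by (intro mult_left_mono) auto
  ultimately have "\<bar>h $ k\<bar> \<le> 7 / 3 * M * lam" by (simp add: mult_ac)
  then show "\<bar>B $$ (k, i) - Om $$ (k, i)\<bar> \<le> 7 / 3 * M * lam"
    using B Om i k by (simp add: h_def)
qed

section \<open>Sparsity, column-sum rates and symmetrization\<close>

text \<open>Each minimum is the product of its powers \<open>q\<close> and \<open>1 - q\<close>; the
  first is bounded through the entry, the second through \<open>t\<close>.\<close>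

lemma sum_min_le_powr:
  fixes w :: "'a \<Rightarrow> real"
  assumes "t > 0" "0 \<le> q" "q < 1" "(\<Sum>i\<in>A. \<bar>w i\<bar> powr q) \<le> s"
  shows "(\<Sum>i\<in>A. min t \<bar>w i\<bar>) \<le> s * t powr (1 - q)"
proof -
  have "min t \<bar>x\<bar> \<le> \<bar>x\<bar> powr q * t powr (1 - q)" for x
  proof (cases "x = 0")
    case False
    have "min t \<bar>x\<bar> = min t \<bar>x\<bar> powr q * min t \<bar>x\<bar> powr (1 - q)"
      using assms(1) False by (simp add: min_def flip: powr_add)
    also have "\<dots> \<le> \<bar>x\<bar> powr q * t powr (1 - q)"
      using assms by (intro mult_mono powr_mono2) auto
    finally show ?thesis .
  qed (use assms in auto)
  then have "(\<Sum>i\<in>A. min t \<bar>w i\<bar>) \<le> (\<Sum>i\<in>A. \<bar>w i\<bar> powr q) * t powr (1 - q)"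
    by (simp add: sum_distrib_right sum_mono)
  also have "\<dots> \<le> s * t powr (1 - q)"
    using assms by (intro mult_right_mono) auto
  finally show ?thesis .
qed

text \<open>The entrywise inequality \<open>\<bar>b - w\<bar> + \<bar>w\<bar> - \<bar>b\<bar> \<le> 2 min t \<bar>w\<bar>\<close> replaces the usual split into
  large and small entries of \<open>w\<close>.\<close>
lemma shrunken_l1_bound:
  fixes w b x :: "'a \<Rightarrow> real"
  assumes cone: "(\<Sum>i\<in>A. \<bar>b i\<bar>) \<le> (\<Sum>i\<in>A. \<bar>w i\<bar>) + 1 / 3 * (\<Sum>i\<in>A. \<bar>b i - w i\<bar>)"
    and b: "\<And>i. i \<in> A \<Longrightarrow> \<bar>b i - w i\<bar> \<le> t"
    and x: "\<And>i. i \<in> A \<Longrightarrow> \<bar>x i - w i\<bar> \<le> t" "\<And>i. i \<in> A \<Longrightarrow> \<bar>x i\<bar> \<le> \<bar>b i\<bar>"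
  shows "(\<Sum>i\<in>A. \<bar>x i - w i\<bar>) \<le> 5 * (\<Sum>i\<in>A. min t \<bar>w i\<bar>)"
proof -
  have "(\<Sum>i\<in>A. \<bar>b i - w i\<bar> + \<bar>w i\<bar> - \<bar>b i\<bar>) \<le> (\<Sum>i\<in>A. 2 * min t \<bar>w i\<bar>)"
    using b by (intro sum_mono) force
  \<comment> \<open>After summation \<open>cone\<close> leaves two thirds of the l1 error on the
    left, against twice the sum of minima: hence the factor 3.\<close>
  then have "(\<Sum>i\<in>A. \<bar>b i - w i\<bar>) \<le> 3 * (\<Sum>i\<in>A. min t \<bar>w i\<bar>)"
    using cone by (simp add: sum.distrib sum_subtractf flip: sum_distrib_left)
  \<comment> \<open>Where \<open>t\<close> is the minimum, \<open>x\<close> is within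
    \<open>t\<close> of \<open>w\<close>. Otherwise the shrinkage of \<open>x\<close> gives at most
    \<open>\<bar>b\<bar> + \<bar>w\<bar>\<close>, hence at most
    \<open>\<bar>b - w\<bar> + 2 * \<bar>w\<bar>\<close>.\<close>
  moreover have "(\<Sum>i\<in>A. \<bar>x i - w i\<bar>) \<le> (\<Sum>i\<in>A. \<bar>b i - w i\<bar> + 2 * min t \<bar>w i\<bar>)"
    using x by (intro sum_mono) force
  ultimately show ?thesis
    by (simp add: sum.distrib flip: sum_distrib_left)
qed

text \<open>The l1 comparison is available for columns of \<open>B\<close>, not of \<open>W\<close>;
  this shrinkage property carries it over.\<close>

lemma symmetrization_abs_le:
  assumes "symmetrization p B W" "i < p" "j < p"
  shows "\<bar>W $$ (i, j)\<bar> \<le> \<bar>B $$ (i, j)\<bar>"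
  using assms unfolding symmetrization_def by (cases "\<bar>B $$ (i, j)\<bar> < \<bar>B $$ (j, i)\<bar>") fastforce+

lemma symmetrized_scio_bounds:
  fixes S Sg Om :: "real mat"
  assumes p: "p \<ge> 1" and Sg: "Sg \<in> carrier_mat p p" and Om: "Om \<in> sparse_class p q s M"
    and inv: "Sg * Om = 1\<^sub>m p" "Om * Sg = 1\<^sub>m p" and q: "0 \<le> q" "q < 1" and M0: "M > 0"
    and S: "sym_possemidef p S"
    and close: "\<And>i j. i < p \<Longrightarrow> j < p \<Longrightarrow> \<bar>S $$ (i, j) - Sg $$ (i, j)\<bar> \<le> d"
    and d: "d * M \<le> lam / 3" and lam: "lam > 0"
    and scio: "scio p lam S B" and W: "symmetrization p B W"
  shows "max_norm (W - Om) \<le> 7 / 3 * M * lam"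
    and "L1_norm (W - Om) \<le> 5 * s * (7 / 3 * M * lam) powr (1 - q)"
proof -
  let ?t = "7 / 3 * M * lam"
  have Om': "Om \<in> carrier_mat p p" "transpose_mat Om = Om"
    using Om by (auto simp: sparse_class_def sym_posdef_def)
  have M: "(\<Sum>i<p. \<bar>Om $$ (i, j)\<bar>) \<le> M" if "j < p" for j
    using Om that p L1_norm_le_iff[OF Om'(1)] by (auto simp: sparse_class_def)
  have S': "S \<in> carrier_mat p p" "transpose_mat S = S"
      "\<And>v. v \<in> carrier_vec p \<Longrightarrow> 0 \<le> v \<bullet> (S *\<^sub>v v)"
    using S by (auto simp: sym_possemidef_def)
  have cone: "(\<Sum>j<p. \<bar>B $$ (j, i)\<bar>) \<le>
      (\<Sum>j<p. \<bar>Om $$ (j, i)\<bar>) + 1 / 3 * (\<Sum>j<p. \<bar>B $$ (j, i) - Om $$ (j, i)\<bar>)"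
    if "i < p" for i
    by (rule scio_column_bounds(1)[OF Sg Om' inv M S' close d lam scio that])
  have supB: "\<bar>B $$ (k, i) - Om $$ (k, i)\<bar> \<le> ?t" if "k < p" "i < p" for k i
    by (rule scio_column_bounds(2)[OF Sg Om' inv M S' close d lam scio that(2,1)])
  have W': "W \<in> carrier_mat p p" "W - Om \<in> carrier_mat p p"
    using W Om' by (auto simp: symmetrization_def)
  have sup: "\<bar>W $$ (i, j) - Om $$ (i, j)\<bar> \<le> ?t" if "i < p" "j < p" for i j
  proof -
    have "W $$ (i, j) = B $$ (i, j) \<or> W $$ (i, j) = B $$ (j, i)"
      using W that by (auto simp: symmetrization_def)
    then show ?thesis
      using supB[of i j] supB[of j i] symmetric_index[OF Om' that] that by auto
  qed
  then show "max_norm (W - Om) \<le> ?t"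
    using W' Om' by (subst max_norm_le_iff[OF W'(2) p]) auto
  have "(\<Sum>i<p. \<bar>W $$ (i, j) - Om $$ (i, j)\<bar>) \<le> 5 * s * ?t powr (1 - q)" if j: "j < p" for j
  proof -
    have "(\<Sum>i<p. \<bar>W $$ (i, j) - Om $$ (i, j)\<bar>) \<le> 5 * (\<Sum>i<p. min ?t \<bar>Om $$ (i, j)\<bar>)"
      using cone[OF j] supB[OF _ j] sup[OF _ j] j symmetrization_abs_le[OF W]
      by (intro shrunken_l1_bound) auto
    also have "\<dots> \<le> 5 * (s * ?t powr (1 - q))"
      using Om j M0 lam q by (intro mult_left_mono sum_min_le_powr) (auto simp: sparse_class_def)
    finally show ?thesis by simp
  qed
  then show "L1_norm (W - Om) \<le> 5 * s * ?t powr (1 - q)"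
    using W' Om' by (subst L1_norm_le_iff[OF W'(2) p]) auto
qed

section \<open>Positive definiteness and the projection\<close>

text \<open>A diagonal entry of a positive definite matrix is positive and bounded by its column
  sum.\<close>

lemma sparse_class_bound_pos:
  assumes "W \<in> sparse_class p q s M" "p \<ge> 1"
  shows "M > 0"
proof -
  have W: "W \<in> carrier_mat p p" and pos: "\<And>v. v \<in> carrier_vec p \<Longrightarrow> v \<noteq> 0\<^sub>v p \<Longrightarrow> 0 < v \<bullet> (W *\<^sub>v v)"
    using assms by (auto simp: sparse_class_def sym_posdef_def)
  have "unit_vec p 0 $ 0 \<noteq> (0\<^sub>v p :: real vec) $ 0" using assms(2) by simp
  then have "0 < unit_vec p 0 \<bullet> (W *\<^sub>v unit_vec p 0)"
    by (intro pos) auto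
  also have "\<dots> = W $$ (0, 0)" using W assms(2) by simp
  also have "\<dots> \<le> \<bar>W $$ (0, 0)\<bar>" by simp
  also have "\<dots> \<le> (\<Sum>i<p. \<bar>W $$ (i, 0)\<bar>)"
    using assms(2) by (intro member_le_sum) auto
  also have "\<dots> \<le> M"
    using assms L1_norm_le_iff[OF W assms(2)] by (auto simp: sparse_class_def)
  finally show ?thesis .
qed

lemma sym_possemidef_shift:
  assumes S: "S \<in> carrier_mat p p" "sym_possemidef p (S - e \<cdot>\<^sub>m 1\<^sub>m p)" and e: "e \<ge> 0"
  shows "sym_possemidef p S"
proof -
  let ?D = "S - e \<cdot>\<^sub>m 1\<^sub>m p"
  have D: "?D \<in> carrier_mat p p" "transpose_mat ?D = ?D"
    using S by (auto simp: sym_possemidef_def)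
  have "transpose_mat S = S"
  proof (rule eq_matI)
    fix i j assume "i < dim_row S" "j < dim_col S"
    then have ij: "i < p" "j < p" using S by auto
    show "transpose_mat S $$ (i, j) = S $$ (i, j)"
      using symmetric_index[OF D ij] S ij by (auto split: if_splits)
  qed (use S in auto)
  moreover have "0 \<le> v \<bullet> (S *\<^sub>v v)" if v: "v \<in> carrier_vec p" for v
  proof -
    have "e \<cdot>\<^sub>m 1\<^sub>m p *\<^sub>v v = e \<cdot>\<^sub>v v"
      using v by (intro eq_vecI) auto
    then have "v \<bullet> (?D *\<^sub>v v) = v \<bullet> (S *\<^sub>v v) - e * (v \<bullet> v)"
      using S v by (simp add: minus_mult_distrib_mat_vec[of _ p p] scalar_prod_minus_distrib[of _ p])
    moreover have "0 \<le> v \<bullet> (?D *\<^sub>v v)" using S(2) v by (simp add: sym_possemidef_def)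
    moreover have "0 \<le> e * (v \<bullet> v)"
      using e v by (intro mult_nonneg_nonneg) (auto simp: scalar_prod_def intro!: sum_nonneg)
    ultimately show ?thesis by linarith
  qed
  ultimately show ?thesis using S(1) by (simp add: sym_possemidef_def)
qed

text \<open>The largest eigenvalue of \<open>Om\<close> is at most \<open>M\<close>, so the smallest
  one of \<open>Sg\<close> is at least \<open>1 / M\<close>.\<close>

lemma covariance_feasible:
  assumes p: "p \<ge> 1" and Sg: "Sg \<in> carrier_mat p p" and Om: "Om \<in> sparse_class p q s M"
    and inv: "Sg * Om = 1\<^sub>m p" "Om * Sg = 1\<^sub>m p" and e: "e \<le> 1 / M"
  shows "sym_possemidef p (Sg - e \<cdot>\<^sub>m 1\<^sub>m p)"
proof -
  let ?D = "Sg - e \<cdot>\<^sub>m 1\<^sub>m p"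
  have M0: "M > 0" by (rule sparse_class_bound_pos[OF Om p])
  have Om': "Om \<in> carrier_mat p p" "transpose_mat Om = Om"
    and pos: "\<And>v. v \<in> carrier_vec p \<Longrightarrow> v \<noteq> 0\<^sub>v p \<Longrightarrow> 0 < v \<bullet> (Om *\<^sub>v v)"
    using Om by (auto simp: sparse_class_def sym_posdef_def)
  have pos': "0 \<le> v \<bullet> (Om *\<^sub>v v)" if "v \<in> carrier_vec p" for v
    using pos[OF that] Om' by (cases "v = 0\<^sub>v p") auto
  have M: "(\<Sum>i<p. \<bar>Om $$ (i, j)\<bar>) \<le> M" if "j < p" for j
    using Om that p L1_norm_le_iff[OF Om'(1)] by (auto simp: sparse_class_def)
  have sym: "transpose_mat Sg = Sg" by (rule inverse_symmetric[OF Sg Om' inv])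
  have "transpose_mat ?D = ?D"
    by (rule eq_matI) (use Sg symmetric_index[OF Sg sym] in auto)
  moreover have "0 \<le> v \<bullet> (?D *\<^sub>v v)" if v: "v \<in> carrier_vec p" for v
  proof -
    have "e \<cdot>\<^sub>m 1\<^sub>m p *\<^sub>v v = e \<cdot>\<^sub>v v"
      using v by (intro eq_vecI) auto
    then have "v \<bullet> (?D *\<^sub>v v) = v \<bullet> (Sg *\<^sub>v v) - e * (v \<bullet> v)"
      using Sg v by (simp add: minus_mult_distrib_mat_vec[of _ p p] scalar_prod_minus_distrib[of _ p])
    moreover have "v \<bullet> v \<le> M * (v \<bullet> (Sg *\<^sub>v v))"
      by (rule inverse_quadratic_ge[OF Sg Om' pos' inv M0 M v])
    then have "1 / M * (v \<bullet> v) \<le> v \<bullet> (Sg *\<^sub>v v)"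
      using M0 by (simp add: field_simps)
    moreover have "0 \<le> v \<bullet> v"
      using v by (auto simp: scalar_prod_def intro!: sum_nonneg)
    then have "e * (v \<bullet> v) \<le> 1 / M * (v \<bullet> v)"
      using e by (intro mult_right_mono)
    ultimately show ?thesis by linarith
  qed
  moreover have "?D \<in> carrier_mat p p" using Sg by auto
  ultimately show ?thesis by (simp add: sym_possemidef_def)
qed

text \<open>\<open>Sg\<close> is a competitor in the minimization, so \<open>S\<close> is no farther
  from \<open>S0\<close> than \<open>Sg\<close> is; the triangle inequality through
  \<open>S0\<close> doubles the error.\<close>

lemma psd_projection_close:
  assumes p: "p \<ge> 1" and proj: "psd_projection p e S0 S" and S0: "S0 \<in> carrier_mat p p"
    and Sg: "Sg \<in> carrier_mat p p" "sym_possemidef p (Sg - e \<cdot>\<^sub>m 1\<^sub>m p)"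
    and close: "\<And>i j. i < p \<Longrightarrow> j < p \<Longrightarrow> \<bar>S0 $$ (i, j) - Sg $$ (i, j)\<bar> \<le> d"
    and ij: "i < p" "j < p"
  shows "\<bar>S $$ (i, j) - Sg $$ (i, j)\<bar> \<le> 2 * d"
proof -
  have S: "S \<in> carrier_mat p p" and "max_norm (S - S0) \<le> max_norm (Sg - S0)"
    using proj Sg by (auto simp: psd_projection_def is_arg_min_def not_less)
  moreover have "Sg - S0 \<in> carrier_mat p p" "S - S0 \<in> carrier_mat p p" using Sg S0 S by auto
  then have "max_norm (Sg - S0) \<le> d"
    using close Sg S0 p by (subst max_norm_le_iff) (auto simp: abs_minus_commute)
  ultimately have "max_norm (S - S0) \<le> d" by linarith
  then have "\<bar>(S - S0) $$ (i, j)\<bar> \<le> d"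
    using max_norm_le_iff[OF \<open>S - S0 \<in> _\<close> p] ij by blast
  then show ?thesis using close[OF ij] S S0 ij by auto
qed

section \<open>Huber estimating equations\<close>

text \<open>Clamping freezes the left side outside \<open>[-1, 1]\<close>, so a quadratic bound
  holds on the whole line and exponential moments need only two moments of the data.\<close>

lemma exp_clamp_le: "exp (min 1 (max (-1) y)) \<le> 1 + y + y\<^sup>2" for y :: real
proof -
  consider "y < -1" | "-1 \<le> y" "y \<le> 0" | "0 \<le> y" "y \<le> 1" | "1 < y" by linarith
  then show ?thesis
  proof cases
    case 1
    then have "0 \<le> (- y) * (- y - 1)" by (intro mult_nonneg_nonneg) auto
    then have "1 \<le> 1 + y + y\<^sup>2" by (simp add: power2_eq_square algebra_simps)
    moreover have "exp (-1 :: real) \<le> 1" by simp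
    moreover have clamp: "min 1 (max (-1) y) = -1" using 1 by simp
    ultimately show ?thesis unfolding clamp by linarith
  next
    case 2
    \<comment> \<open>The product telescopes to \<open>1 - y ^ 3\<close>; with
      \<open>1 - y \<le> exp (- y)\<close> this bounds \<open>exp y\<close> for negative
      \<open>y\<close>.\<close>
    have "1 \<le> (1 + y + y\<^sup>2) * (1 - y)"
    proof -
      have "(1 + y + y\<^sup>2) * (1 - y) = 1 - y ^ 3"
        by (simp add: algebra_simps power2_eq_square power3_eq_cube)
      moreover have "y ^ 3 \<le> 0" using 2 by (simp add: power_le_zero_eq)
      ultimately show ?thesis by simp
    qed
    also have "\<dots> \<le> (1 + y + y\<^sup>2) * exp (- y)"
    proof (rule mult_left_mono)
      show "1 - y \<le> exp (- y)" using exp_ge_add_one_self[of "- y"] by simp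
      show "0 \<le> 1 + y + y\<^sup>2" using 2 zero_le_power2[of y] by linarith
    qed
    finally have "exp y \<le> 1 + y + y\<^sup>2"
      by (simp add: exp_minus field_simps)
    then show ?thesis using 2 by (simp add: min_def max_def)
  next
    case 3
    then show ?thesis using exp_bound[of y] by (simp add: min_def max_def)
  next
    case 4
    then have "1 \<le> y\<^sup>2" by (simp add: one_le_power)
    moreover have clamp: "min 1 (max (-1) y) = 1" using 4 by simp
    ultimately show ?thesis unfolding clamp using 4 exp_le by linarith
  qed
qed

lemma exp_huber_psi_le:
  assumes "H > 0"
  shows "exp (huber_psi H x / H) \<le> 1 + x / H + (x / H)\<^sup>2"
proof -
  have "huber_psi H x / H = min 1 (max (-1) (x / H))"
    using assms by (auto simp: huber_psi_def min_def max_def field_simps)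
  then show ?thesis using exp_clamp_le[of "x / H"] by simp
qed

lemma huber_psi_mono: "x \<le> y \<Longrightarrow> huber_psi H x \<le> huber_psi H y"
  by (auto simp: huber_psi_def min_def max_def)

lemma huber_psi_minus: "H \<ge> 0 \<Longrightarrow> huber_psi H (- x) = - huber_psi H x"
  by (auto simp: huber_psi_def min_def max_def)

lemma abs_huber_psi_le: "H \<ge> 0 \<Longrightarrow> \<bar>huber_psi H x\<bar> \<le> H"
  by (auto simp: huber_psi_def min_def max_def)

lemma borel_measurable_huber_psi [measurable]: "huber_psi H \<in> borel_measurable borel"
  unfolding huber_psi_def by measurable

section \<open>Exponential moments and tails of the Huber score\<close>

context prob_space
begin

text \<open>Expanding the quadratic bound around the mean kills its linear part under expectation,
  and the shift \<open>d\<close> turns \<open>v\<close> into \<open>v + d\<^sup>2\<close>. The final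
  \<open>1 + r \<le> exp r\<close> gives a form that multiplies over the sample.\<close>

lemma expectation_exp_huber_psi_le:
  fixes Z :: "'a \<Rightarrow> real"
  assumes H: "H > 0" and Z: "integrable M Z" "integrable M (\<lambda>x. (Z x - expectation Z)\<^sup>2)"
    and v: "variance Z \<le> v"
  shows "integrable M (\<lambda>x. exp (huber_psi H (Z x - (expectation Z + d)) / H))"
    and "expectation (\<lambda>x. exp (huber_psi H (Z x - (expectation Z + d)) / H))
      \<le> exp (- d / H + (v + d\<^sup>2) / H\<^sup>2)"
proof -
  let ?m = "expectation Z"
  let ?f = "\<lambda>x. exp (huber_psi H (Z x - (?m + d)) / H)"
  have [measurable]: "Z \<in> borel_measurable M" using Z by auto
  show int: "integrable M ?f"
  proof (rule integrable_const_bound)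
    have "huber_psi H y / H \<le> 1" for y
      using H abs_huber_psi_le[of H y] by (simp add: divide_le_eq)
    then show "AE x in M. norm (?f x) \<le> exp 1" by simp
  qed measurable
  define g where "g x = (Z x - ?m)\<^sup>2 / H\<^sup>2 + (1 / H - 2 * d / H\<^sup>2) * (Z x - ?m)
      + (1 - d / H + d\<^sup>2 / H\<^sup>2)" for x
  have ig: "integrable M g" using Z unfolding g_def by auto
  have "?f x \<le> g x" for x
  proof -
    have "?f x \<le> 1 + (Z x - (?m + d)) / H + ((Z x - (?m + d)) / H)\<^sup>2"
      by (rule exp_huber_psi_le[OF H])
    also have "\<dots> = g x"
      using H by (simp add: g_def field_simps power2_eq_square)
    finally show ?thesis .
  qed
  then have "expectation ?f \<le> expectation g"
    by (intro integral_mono int ig)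
  also have "expectation g = variance Z / H\<^sup>2 + (1 - d / H + d\<^sup>2 / H\<^sup>2)"
    using Z unfolding g_def by (simp add: prob_space)
  also have "\<dots> \<le> v / H\<^sup>2 + (1 - d / H + d\<^sup>2 / H\<^sup>2)"
    using v by (intro add_right_mono divide_right_mono) auto
  also have "\<dots> = 1 + (- d / H + (v + d\<^sup>2) / H\<^sup>2)"
    by (simp add: add_divide_distrib)
  also have "\<dots> \<le> exp (- d / H + (v + d\<^sup>2) / H\<^sup>2)"
    by (rule exp_ge_add_one_self)
  finally show "expectation ?f \<le> exp (- d / H + (v + d\<^sup>2) / H\<^sup>2)" .
qed

text \<open>The score is nonnegative exactly when the product of the exponentials is at least 1.
  Markov's inequality and independence then apply, with the exponential scale fixed at
  \<open>1 / H\<close> so that the quadratic bound is available.\<close>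

lemma huber_upper_tail:
  fixes Z :: "nat \<Rightarrow> 'a \<Rightarrow> real"
  assumes indep: "indep_vars (\<lambda>_. borel) Z {..<n}" and H: "H > 0"
    and Z: "\<And>k. k < n \<Longrightarrow> integrable M (Z k)" "\<And>k. k < n \<Longrightarrow> expectation (Z k) = m"
      "\<And>k. k < n \<Longrightarrow> integrable M (\<lambda>x. (Z k x - m)\<^sup>2)"
    and v: "\<And>k. k < n \<Longrightarrow> expectation (\<lambda>x. (Z k x - m)\<^sup>2) \<le> v"
  shows "prob {x \<in> space M. (\<Sum>k<n. huber_psi H (Z k x - (m + d))) \<ge> 0}
    \<le> exp (real n * (- d / H + (v + d\<^sup>2) / H\<^sup>2))"
proof -
  let ?f = "\<lambda>k x. exp (huber_psi H (Z k x - (m + d)) / H)"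
  let ?r = "- d / H + (v + d\<^sup>2) / H\<^sup>2"
  have E: "integrable M (?f k)" "expectation (?f k) \<le> exp ?r" if "k < n" for k
    using expectation_exp_huber_psi_le[OF H, of "Z k" v d] Z[OF that] v[OF that] by simp_all
  have indep': "indep_vars (\<lambda>_. borel) ?f {..<n}"
    by (rule indep_vars_compose2[OF indep]) measurable
  have prod: "(\<Prod>k<n. ?f k x) = exp ((\<Sum>k<n. huber_psi H (Z k x - (m + d))) / H)" for x
    by (simp add: exp_sum sum_divide_distrib)
  have int: "integrable M (\<lambda>x. \<Prod>k<n. ?f k x)"
    by (rule indep_vars_integrable[OF _ indep']) (use E in auto)
  have "prob {x \<in> space M. (\<Sum>k<n. huber_psi H (Z k x - (m + d))) \<ge> 0}
      = prob {x \<in> space M. (\<Prod>k<n. ?f k x) \<ge> 1}"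
    using H unfolding prod by (simp add: zero_le_divide_iff)
  also have "\<dots> \<le> expectation (\<lambda>x. \<Prod>k<n. ?f k x) / 1"
    by (rule integral_Markov_inequality_measure[OF int sets.empty_sets]) (auto intro!: AE_I2 prod_nonneg)
  also have "\<dots> = (\<Prod>k<n. expectation (?f k))"
    by (simp, rule indep_vars_lebesgue_integral[OF _ indep']) (use E in auto)
  also have "\<dots> \<le> (\<Prod>k<n. exp ?r)"
    using E by (intro prod_mono) auto
  also have "\<dots> = exp (real n * ?r)"
    by (simp add: exp_of_nat_mult)
  finally show ?thesis .
qed

text \<open>Since \<open>huber_psi H\<close> is odd, this is the upper tail for the negated
  sample.\<close>

lemma huber_lower_tail:
  fixes Z :: "nat \<Rightarrow> 'a \<Rightarrow> real"
  assumes indep: "indep_vars (\<lambda>_. borel) Z {..<n}" and H: "H > 0"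
    and Z: "\<And>k. k < n \<Longrightarrow> integrable M (Z k)" "\<And>k. k < n \<Longrightarrow> expectation (Z k) = m"
      "\<And>k. k < n \<Longrightarrow> integrable M (\<lambda>x. (Z k x - m)\<^sup>2)"
    and v: "\<And>k. k < n \<Longrightarrow> expectation (\<lambda>x. (Z k x - m)\<^sup>2) \<le> v"
  shows "prob {x \<in> space M. (\<Sum>k<n. huber_psi H (Z k x - (m - d))) \<le> 0}
    \<le> exp (real n * (- d / H + (v + d\<^sup>2) / H\<^sup>2))"
proof -
  have "indep_vars (\<lambda>_. borel) (\<lambda>k x. - Z k x) {..<n}"
    by (rule indep_vars_compose2[OF indep]) measurable
  moreover have sq: "(- Z k x - - m)\<^sup>2 = (Z k x - m)\<^sup>2" for k x
    by (simp add: power2_eq_square algebra_simps)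
  ultimately have "prob {x \<in> space M. (\<Sum>k<n. huber_psi H (- Z k x - (- m + d))) \<ge> 0}
      \<le> exp (real n * (- d / H + (v + d\<^sup>2) / H\<^sup>2))"
    using Z v by (intro huber_upper_tail H) (simp_all only: sq, auto)
  moreover have "huber_psi H (- Z k x - (- m + d)) = - huber_psi H (Z k x - (m - d))" for k x
    using huber_psi_minus[of H "Z k x - (m - d)"] H by (simp add: algebra_simps)
  ultimately show ?thesis by (simp add: sum_negf)
qed

text \<open>The empirical score is nonincreasing in the location, so its signs at \<open>m i - d\<close> and
  \<open>m i + d\<close> confine all its zeros.\<close>
lemma huber_roots_event:
  fixes Z :: "'i \<Rightarrow> nat \<Rightarrow> 'a \<Rightarrow> real" and m :: "'i \<Rightarrow> real"
  assumes I: "finite I" and H: "H > 0"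
    and indep: "\<And>i. i \<in> I \<Longrightarrow> indep_vars (\<lambda>_. borel) (Z i) {..<n}"
    and Z: "\<And>i k. i \<in> I \<Longrightarrow> k < n \<Longrightarrow> integrable M (Z i k)"
      "\<And>i k. i \<in> I \<Longrightarrow> k < n \<Longrightarrow> expectation (Z i k) = m i"
      "\<And>i k. i \<in> I \<Longrightarrow> k < n \<Longrightarrow> integrable M (\<lambda>x. (Z i k x - m i)\<^sup>2)"
      "\<And>i k. i \<in> I \<Longrightarrow> k < n \<Longrightarrow> expectation (\<lambda>x. (Z i k x - m i)\<^sup>2) \<le> v"
  obtains E where "E \<in> events"
    "prob E \<ge> 1 - 2 * real (card I) * exp (real n * (- d / H + (v + d\<^sup>2) / H\<^sup>2))"
    "\<And>x i \<theta>. x \<in> E \<Longrightarrow> i \<in> I \<Longrightarrow> (\<Sum>k<n. huber_psi H (Z i k x - \<theta>)) = 0 \<Longrightarrow> \<bar>\<theta> - m i\<bar> \<le> d"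
proof -
  let ?p = "exp (real n * (- d / H + (v + d\<^sup>2) / H\<^sup>2))"
  define U where "U i = {x \<in> space M. (\<Sum>k<n. huber_psi H (Z i k x - (m i + d))) \<ge> 0}" for i
  define L where "L i = {x \<in> space M. (\<Sum>k<n. huber_psi H (Z i k x - (m i - d))) \<le> 0}" for i
  have [measurable]: "U i \<in> events" "L i \<in> events" if "i \<in> I" for i
  proof -
    have [measurable]: "Z i k \<in> borel_measurable M" if "k \<in> {..<n}" for k
      using Z(1)[OF \<open>i \<in> I\<close>, of k] that by auto
    show "U i \<in> events" "L i \<in> events" unfolding U_def L_def by measurable
  qed
  have UL: "prob (U i) \<le> ?p" "prob (L i) \<le> ?p" if "i \<in> I" for i
    unfolding U_def L_def using indep[OF that] H Z[OF that]
    by (intro huber_upper_tail huber_lower_tail; simp)+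
  define E where "E = space M - (\<Union>i\<in>I. U i \<union> L i)"
  have ev: "(\<Union>i\<in>I. U i \<union> L i) \<in> events" using I by auto
  have "prob (\<Union>i\<in>I. U i \<union> L i) \<le> (\<Sum>i\<in>I. prob (U i \<union> L i))"
    using I by (intro finite_measure_subadditive_finite) auto
  also have "\<dots> \<le> (\<Sum>i\<in>I. 2 * ?p)"
  proof (rule sum_mono)
    fix i assume i: "i \<in> I"
    have "prob (U i \<union> L i) \<le> prob (U i) + prob (L i)"
      using i by (intro measure_Un_le) auto
    then show "prob (U i \<union> L i) \<le> 2 * ?p" using UL[OF i] by linarith
  qed
  finally have "prob E \<ge> 1 - 2 * real (card I) * ?p"
    unfolding E_def using prob_compl[OF ev] by (simp add: mult_ac)
  moreover have "\<bar>\<theta> - m i\<bar> \<le> d"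
    if x: "x \<in> E" and i: "i \<in> I" and root: "(\<Sum>k<n. huber_psi H (Z i k x - \<theta>)) = 0" for x i \<theta>
  proof -
    have U: "(\<Sum>k<n. huber_psi H (Z i k x - (m i + d))) < 0"
      and L: "(\<Sum>k<n. huber_psi H (Z i k x - (m i - d))) > 0"
      using x i by (auto simp: E_def U_def L_def)
    have mono: "(\<Sum>k<n. huber_psi H (Z i k x - a)) \<ge> (\<Sum>k<n. huber_psi H (Z i k x - b))"
      if "a \<le> b" for a b
      using that by (intro sum_mono huber_psi_mono) auto
    have "\<theta> \<le> m i + d" using mono[of "m i + d" \<theta>] U root by linarith
    moreover have "m i - d \<le> \<theta>" using mono[of \<theta> "m i - d"] L root by linarith
    ultimately show ?thesis by linarith
  qed
  moreover have "E \<in> events" using ev by (auto simp: E_def)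
  ultimately show ?thesis using that by blast
qed

end

section \<open>Moment bounds and the pilot covariance matrix\<close>

context prob_space
begin

lemma variance_le_fourth_moment:
  fixes Y :: "'a \<Rightarrow> real"
  assumes "integrable M (\<lambda>x. (Y x)\<^sup>2)" "integrable M (\<lambda>x. Y x ^ 4)" "expectation (\<lambda>x. Y x ^ 4) \<le> K"
  shows "expectation (\<lambda>x. (Y x)\<^sup>2) \<le> 1 + K"
proof -
  have "y\<^sup>2 \<le> 1 + y ^ 4" for y :: real
  proof -
    have "2 * y\<^sup>2 \<le> y ^ 4 + 1"
      using sum_squares_bound[of "y\<^sup>2" 1] by (simp flip: power_mult)
    then show ?thesis using zero_le_power2[of y] by linarith
  qed
  then have "expectation (\<lambda>x. (Y x)\<^sup>2) \<le> expectation (\<lambda>x. 1 + Y x ^ 4)"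
    using assms by (intro integral_mono) auto
  also have "\<dots> \<le> 1 + K"
    using assms by (simp add: prob_space)
  finally show ?thesis .
qed

text \<open>Uncentred fourth moments are bounded by centred ones and \<open>B ^ 4\<close>, and the
  inequality of arithmetic and geometric means reduces the squared product to these fourth
  moments.\<close>

lemma product_moments:
  fixes U V :: "'a \<Rightarrow> real"
  assumes U: "integrable M U" "expectation U = u" "\<bar>u\<bar> \<le> B"
      "integrable M (\<lambda>x. (U x - u) ^ 4)" "expectation (\<lambda>x. (U x - u) ^ 4) \<le> K"
    and V: "integrable M V" "expectation V = v" "\<bar>v\<bar> \<le> B"
      "integrable M (\<lambda>x. (V x - v) ^ 4)" "expectation (\<lambda>x. (V x - v) ^ 4) \<le> K"
    and UV: "integrable M (\<lambda>x. (U x - u) * (V x - v))" "expectation (\<lambda>x. (U x - u) * (V x - v)) = c"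
  shows "integrable M (\<lambda>x. U x * V x)" "expectation (\<lambda>x. U x * V x) = c + u * v"
    "integrable M (\<lambda>x. (U x * V x - (c + u * v))\<^sup>2)"
    "expectation (\<lambda>x. (U x * V x - (c + u * v))\<^sup>2) \<le> 8 * (K + B ^ 4)"
proof -
  have eq: "U x * V x = (U x - u) * (V x - v) + u * V x + v * U x - u * v" for x
    by (simp add: algebra_simps)
  show int: "integrable M (\<lambda>x. U x * V x)"
    unfolding eq using U V UV by auto
  have "expectation (\<lambda>x. (U x - u) * (V x - v) + u * V x + v * U x - u * v) = c + u * v"
    using U V UV by (simp add: prob_space)
  then show E: "expectation (\<lambda>x. U x * V x) = c + u * v"
    by (simp only: eq[symmetric])
  have fourth: "y ^ 4 \<le> 8 * ((y - w) ^ 4 + B ^ 4)" if "\<bar>w\<bar> \<le> B" for y w :: real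
  proof -
    have sq: "(a + b)\<^sup>2 \<le> 2 * (a\<^sup>2 + b\<^sup>2)" for a b :: real
      using sum_squares_bound[of a b] by (simp add: power2_sum)
    have "y ^ 4 = (((y - w) + w)\<^sup>2)\<^sup>2" by (simp flip: power_mult)
    also have "\<dots> \<le> (2 * ((y - w)\<^sup>2 + w\<^sup>2))\<^sup>2"
      by (intro power_mono sq) simp
    also have "\<dots> \<le> 4 * (2 * (((y - w)\<^sup>2)\<^sup>2 + (w\<^sup>2)\<^sup>2))"
      using sq[of "(y - w)\<^sup>2" "w\<^sup>2"] by (simp only: power_mult_distrib) simp
    also have "\<dots> = 8 * ((y - w) ^ 4 + \<bar>w\<bar> ^ 4)"
      by (simp add: power_even_abs flip: power_mult)
    also have "\<dots> \<le> 8 * ((y - w) ^ 4 + B ^ 4)"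
      using that by (intro mult_left_mono add_left_mono power_mono) auto
    finally show ?thesis .
  qed
  define g where "g x = 4 * (U x - u) ^ 4 + 4 * (V x - v) ^ 4 + 8 * B ^ 4" for x
  have g: "integrable M g" unfolding g_def using U V by auto
  have le: "(U x * V x)\<^sup>2 \<le> g x" for x
  proof -
    have "2 * (U x)\<^sup>2 * (V x)\<^sup>2 \<le> ((U x)\<^sup>2)\<^sup>2 + ((V x)\<^sup>2)\<^sup>2"
      by (rule sum_squares_bound)
    then have "2 * (U x * V x)\<^sup>2 \<le> U x ^ 4 + V x ^ 4"
      by (simp add: power_mult_distrib flip: power_mult)
    moreover have "y \<le> 4 * c1 + 4 * c2 + 8 * e"
      if "2 * y \<le> y1 + y2" "y1 \<le> 8 * (c1 + e)" "y2 \<le> 8 * (c2 + e)" for y y1 y2 c1 c2 e :: real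
      using that by argo
    ultimately show ?thesis
      using fourth[OF U(3), of "U x"] fourth[OF V(3), of "V x"] unfolding g_def by blast
  qed
  have [measurable]: "U \<in> borel_measurable M" "V \<in> borel_measurable M" using U V by auto
  have sq: "integrable M (\<lambda>x. (U x * V x)\<^sup>2)"
    by (rule Bochner_Integration.integrable_bound[OF g])
      (use le in \<open>auto intro!: AE_I2 order_trans[OF le abs_ge_self]\<close>)
  have expand: "(U x * V x - (c + u * v))\<^sup>2 =
      (U x * V x)\<^sup>2 - 2 * (c + u * v) * (U x * V x) + (c + u * v)\<^sup>2" for x
    by (simp add: power2_diff)
  show "integrable M (\<lambda>x. (U x * V x - (c + u * v))\<^sup>2)"
    unfolding expand using sq int by auto
  \<comment> \<open>The variance of the product is at most its second moment.\<close>
  have "expectation (\<lambda>x. (U x * V x - (c + u * v))\<^sup>2) = expectation (\<lambda>x. (U x * V x)\<^sup>2) - (c + u * v)\<^sup>2"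
    using variance_eq[OF int sq] by (simp only: E)
  also have "\<dots> \<le> expectation (\<lambda>x. (U x * V x)\<^sup>2)" by simp
  also have "\<dots> \<le> expectation g"
    using sq g le by (intro integral_mono) auto
  also have "\<dots> \<le> 8 * (K + B ^ 4)"
    unfolding g_def using U V by (simp add: prob_space)
  finally show "expectation (\<lambda>x. (U x * V x - (c + u * v))\<^sup>2) \<le> 8 * (K + B ^ 4)" .
qed

lemma iid_vectors_indep:
  assumes "iid_vectors M n p X" "f \<in> borel_measurable (\<Pi>\<^sub>M i\<in>{..<p}. borel)"
  shows "indep_vars (\<lambda>_. borel) (\<lambda>k x. f (\<lambda>i\<in>{..<p}. X k i x)) {..<n}"
proof -
  have "indep_vars (\<lambda>_. \<Pi>\<^sub>M i\<in>{..<p}. borel) (\<lambda>k x. \<lambda>i\<in>{..<p}. X k i x) {..<n}"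
    using assms(1) by (simp add: iid_vectors_def Let_def)
  then show ?thesis
    by (rule indep_vars_compose2[where Y = "\<lambda>_. f"]) (rule assms(2))
qed

text \<open>One event controls the roots for all coordinates and all raw products. Subtracting the
  product of the estimated means from the estimated raw moment then recovers the covariance.\<close>

lemma huber_cov_event:
  fixes X :: "nat \<Rightarrow> nat \<Rightarrow> 'a \<Rightarrow> real" and \<mu> :: "real vec" and Sg :: "real mat"
  assumes p: "p \<ge> 1" and iid: "iid_vectors M n p X"
    and mean: "\<And>k i. k < n \<Longrightarrow> i < p \<Longrightarrow> integrable M (X k i) \<and> expectation (X k i) = \<mu> $ i"
    and cov: "\<And>k i j. k < n \<Longrightarrow> i < p \<Longrightarrow> j < p \<Longrightarrow>
      integrable M (\<lambda>x. (X k i x - \<mu> $ i) * (X k j x - \<mu> $ j)) \<and>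
      expectation (\<lambda>x. (X k i x - \<mu> $ i) * (X k j x - \<mu> $ j)) = Sg $$ (i, j)"
    and moment: "\<And>k i. k < n \<Longrightarrow> i < p \<Longrightarrow> integrable M (\<lambda>x. (X k i x - \<mu> $ i) ^ 4) \<and>
      expectation (\<lambda>x. (X k i x - \<mu> $ i) ^ 4) \<le> K"
    and B: "\<And>i. i < p \<Longrightarrow> \<bar>\<mu> $ i\<bar> \<le> B" and K: "K \<ge> 0" and K': "K' > 0"
    and a: "a > 0" "real n * a\<^sup>2 = ln p"
    and v: "v = 1 + K + 8 * (K + B ^ 4)" and c: "c = K' * (3 + (v + 1) / K'\<^sup>2)" and ca: "c * a \<le> 1"
  obtains E where "E \<in> events" "prob E \<ge> 1 - 4 / real p"
    "\<And>x m S0 i j. x \<in> E \<Longrightarrow> huber_mean n p (K' / a) (\<lambda>k i. X k i x) m \<Longrightarrow>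
      huber_cov n p (K' / a) (\<lambda>k i. X k i x) m S0 \<Longrightarrow> i < p \<Longrightarrow> j < p \<Longrightarrow>
      \<bar>S0 $$ (i, j) - Sg $$ (i, j)\<bar> \<le> (2 * B + 2) * c * a"
proof -
  txt \<open>The choice of \<open>c\<close> makes each tail at most \<open>1 / p ^ 3\<close>, small enough for a union bound
    over \<open>p + p\<^sup>2\<close> equations.\<close>
  define H where "H = K' / a"
  define d where "d = c * a"
  have H: "H > 0" using K' a by (simp add: H_def)
  have B0: "B \<ge> 0" using B[of 0] p by auto
  have Bv: "0 \<le> 8 * (K + B ^ 4)" using K B0 by simp
  then have v0: "v > 0" using K unfolding v by linarith
  have c0: "c > 0" using K' v0 by (simp add: c add_pos_pos)
  have d01: "0 < d" "d \<le> 1" using c0 a ca by (auto simp: d_def)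
  \<comment> \<open>The disjoint sum lets a single union bound treat the mean equations
    (\<open>Inl\<close>) and the product equations (\<open>Inr\<close>) together.\<close>
  define I where "I = {..<p} <+> {..<p} \<times> {..<p}"
  define Z where "Z = case_sum (\<lambda>i k x. X k i x) (\<lambda>(i, j) k x. X k i x * X k j x)"
  define z where "z = case_sum (\<lambda>i. \<mu> $ i) (\<lambda>(i, j). Sg $$ (i, j) + \<mu> $ i * \<mu> $ j)"
  have I: "finite I" by (simp add: I_def)
  have indep: "indep_vars (\<lambda>_. borel) (Z i) {..<n}" if i: "i \<in> I" for i
  proof -
    consider (l) i' where "i = Inl i'" "i' < p" | (r) i' j where "i = Inr (i', j)" "i' < p" "j < p"
      using i by (auto simp: I_def)
    then show ?thesis
    proof cases
      case l
      then show ?thesis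
        using iid_vectors_indep[OF iid, of "\<lambda>f. f i'"] by (simp add: Z_def)
    next
      case r
      then show ?thesis
        using iid_vectors_indep[OF iid, of "\<lambda>f. f i' * f j"] by (simp add: Z_def)
    qed
  qed
  have moments: "integrable M (Z i k) \<and> expectation (Z i k) = z i \<and>
      integrable M (\<lambda>x. (Z i k x - z i)\<^sup>2) \<and> expectation (\<lambda>x. (Z i k x - z i)\<^sup>2) \<le> v"
    if i: "i \<in> I" and k: "k < n" for i k
  proof -
    consider (l) i' where "i = Inl i'" "i' < p" | (r) i' j where "i = Inr (i', j)" "i' < p" "j < p"
      using i by (auto simp: I_def)
    then show ?thesis
    proof cases
      case l
      have "integrable M (\<lambda>x. (X k i' x - \<mu> $ i')\<^sup>2)"
        using cov[OF k l(2) l(2)] by (simp add: power2_eq_square)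
      moreover have "expectation (\<lambda>x. (X k i' x - \<mu> $ i')\<^sup>2) \<le> 1 + K"
        using calculation moment[OF k l(2)] by (intro variance_le_fourth_moment) auto
      \<comment> \<open>\<open>v\<close> adds the bounds for the two kinds of variables, so it
        dominates each.\<close>
      moreover have "1 + K \<le> v" using Bv unfolding v by linarith
      ultimately show ?thesis using mean[OF k l(2)] by (auto simp: l Z_def z_def)
    next
      case r
      note m = product_moments[of "X k i'" "\<mu> $ i'" B K "X k j" "\<mu> $ j" "Sg $$ (i', j)"]
      have "8 * (K + B ^ 4) \<le> v" using K unfolding v by linarith
      then show ?thesis
        using m mean[OF k r(2)] mean[OF k r(3)] B[OF r(2)] B[OF r(3)]
          moment[OF k r(2)] moment[OF k r(3)] cov[OF k r(2,3)]
        by (simp add: r Z_def z_def)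
    qed
  qed
  obtain E where E: "E \<in> events"
      "prob E \<ge> 1 - 2 * real (card I) * exp (real n * (- d / H + (v + d\<^sup>2) / H\<^sup>2))"
      "\<And>x i \<theta>. x \<in> E \<Longrightarrow> i \<in> I \<Longrightarrow> (\<Sum>k<n. huber_psi H (Z i k x - \<theta>)) = 0 \<Longrightarrow> \<bar>\<theta> - z i\<bar> \<le> d"
    by (rule huber_roots_event[where Z = Z and m = z and n = n and v = v and d = d, OF I H indep])
      (use moments in auto)
  \<comment> \<open>Here \<open>n * a\<^sup>2 = ln p\<close> absorbs the sample size;
    \<open>d \<le> 1\<close> and the choice of \<open>c\<close> then make the remaining factor at
    most \<open>-3\<close>.\<close>
  have "real n * (- d / H + (v + d\<^sup>2) / H\<^sup>2) = ln p * (- c / K' + (v + d\<^sup>2) / K'\<^sup>2)"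
    using a K' by (simp add: a(2)[symmetric] H_def d_def field_simps power2_eq_square)
  also have "\<dots> \<le> ln p * (- 3)"
  proof (rule mult_left_mono)
    have "(v + d\<^sup>2) / K'\<^sup>2 \<le> (v + 1) / K'\<^sup>2"
      using d01 by (intro divide_right_mono add_left_mono) (auto simp: power_le_one)
    moreover have "c / K' = 3 + (v + 1) / K'\<^sup>2" using K' by (simp add: c)
    ultimately show "- c / K' + (v + d\<^sup>2) / K'\<^sup>2 \<le> - 3" by simp
  qed (use p in auto)
  finally have "exp (real n * (- d / H + (v + d\<^sup>2) / H\<^sup>2)) \<le> exp (ln p * (- 3))" by simp
  also have "\<dots> = 1 / real p ^ 3"
    using p by (simp add: exp_minus exp_of_nat2_mult[of "ln p" 3, simplified] divide_inverse)
  finally have tail: "exp (real n * (- d / H + (v + d\<^sup>2) / H\<^sup>2)) \<le> 1 / real p ^ 3" .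
  \<comment> \<open>There are \<open>p + p\<^sup>2\<close> equations with two tails each, so the
    total failure probability is at most \<open>4 / p\<close>.\<close>
  have "real (card I) \<le> 2 * (real p)\<^sup>2"
    using p by (simp add: I_def card_Plus power2_eq_square)
  then have "2 * real (card I) * exp (real n * (- d / H + (v + d\<^sup>2) / H\<^sup>2)) \<le> 4 * (real p)\<^sup>2 * (1 / real p ^ 3)"
    using tail by - (rule mult_mono, linarith, simp_all)
  also have "\<dots> = 4 / real p" using p by (simp add: field_simps power2_eq_square power3_eq_cube)
  finally have "prob E \<ge> 1 - 4 / real p" using E(2) by linarith
  moreover have "\<bar>S0 $$ (i, j) - Sg $$ (i, j)\<bar> \<le> (2 * B + 2) * c * a"
    if x: "x \<in> E" and m: "huber_mean n p (K' / a) (\<lambda>k i. X k i x) m"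
      and S0: "huber_cov n p (K' / a) (\<lambda>k i. X k i x) m S0" and ij: "i < p" "j < p" for x m S0 i j
  proof -
    have m: "\<bar>m $ i - \<mu> $ i\<bar> \<le> d" if "i < p" for i
      using E(3)[OF x, of "Inl i" "m $ i"] m that by (auto simp: I_def Z_def z_def huber_mean_def H_def)
    have "\<bar>(S0 $$ (i, j) + m $ i * m $ j) - (Sg $$ (i, j) + \<mu> $ i * \<mu> $ j)\<bar> \<le> d"
      using E(3)[OF x, of "Inr (i, j)" "S0 $$ (i, j) + m $ i * m $ j"] S0 ij
      by (auto simp: I_def Z_def z_def huber_cov_def H_def)
    \<comment> \<open>Since \<open>d \<le> 1\<close>, the estimated means are bounded by
      \<open>B + 1\<close>.\<close>
    moreover have "\<bar>m $ i * m $ j - \<mu> $ i * \<mu> $ j\<bar> \<le> d * (B + 1) + B * d"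
    proof -
      have "m $ i * m $ j - \<mu> $ i * \<mu> $ j = (m $ i - \<mu> $ i) * m $ j + \<mu> $ i * (m $ j - \<mu> $ j)"
        by (simp add: algebra_simps)
      moreover have "\<bar>(m $ i - \<mu> $ i) * m $ j\<bar> \<le> d * (B + 1)"
        unfolding abs_mult using m[OF ij(1)] m[OF ij(2)] B[OF ij(2)] d01 by (intro mult_mono) auto
      moreover have "\<bar>\<mu> $ i * (m $ j - \<mu> $ j)\<bar> \<le> B * d"
        unfolding abs_mult using m[OF ij(2)] B[OF ij(1)] B0 by (intro mult_mono) auto
      ultimately show ?thesis by linarith
    qed
    ultimately have "\<bar>S0 $$ (i, j) - Sg $$ (i, j)\<bar> \<le> d + (d * (B + 1) + B * d)" by linarith
    also have "\<dots> = (2 * B + 2) * c * a" by (simp add: d_def algebra_simps)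
    finally show ?thesis .
  qed
  ultimately show ?thesis using that E(1) by blast
qed

end

text \<open>The hypothesis \<open>mean_bounded\<close> enters through the raw products in the Huber
  equations, whose variances depend on the means. The event \<open>E\<close> is chosen before
  \<open>W\<close>, so the bounds hold simultaneously for every admissible value of the estimator;
  the constants are chosen after \<open>C0\<close> but before \<open>n\<close>.\<close>

theorem corollary2:
  fixes P :: "nat \<Rightarrow> 'w measure"
    and p :: "nat \<Rightarrow> nat"
    and X :: "nat \<Rightarrow> nat \<Rightarrow> nat \<Rightarrow> 'w \<Rightarrow> real"
    and \<mu> :: "nat \<Rightarrow> real vec"
    and \<Sigma> \<Omega> :: "nat \<Rightarrow> real mat"
    and s M :: "nat \<Rightarrow> real"
    and q K K' B :: real
  assumes prob: "\<And>n. n \<ge> 1 \<Longrightarrow> prob_space (P n)"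
    and dim: "\<And>n. n \<ge> 1 \<Longrightarrow> p n \<ge> 1"
    and iid: "\<And>n. n \<ge> 1 \<Longrightarrow> iid_vectors (P n) n (p n) (X n)"
    and mean_dim: "\<And>n. n \<ge> 1 \<Longrightarrow> \<mu> n \<in> carrier_vec (p n)"
    and mean: "\<And>n k i. k < n \<Longrightarrow> i < p n \<Longrightarrow>
      integrable (P n) (X n k i) \<and> prob_space.expectation (P n) (X n k i) = \<mu> n $ i"
    and Sigma_dim: "\<And>n. n \<ge> 1 \<Longrightarrow> \<Sigma> n \<in> carrier_mat (p n) (p n)"
    and cov: "\<And>n k i j. k < n \<Longrightarrow> i < p n \<Longrightarrow> j < p n \<Longrightarrow>
      integrable (P n) (\<lambda>\<omega>. (X n k i \<omega> - \<mu> n $ i) * (X n k j \<omega> - \<mu> n $ j)) \<and>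
      prob_space.expectation (P n) (\<lambda>\<omega>. (X n k i \<omega> - \<mu> n $ i) * (X n k j \<omega> - \<mu> n $ j))
        = \<Sigma> n $$ (i, j)"
    and precision: "\<And>n. n \<ge> 1 \<Longrightarrow> inverts_mat (\<Sigma> n) (\<Omega> n) \<and> inverts_mat (\<Omega> n) (\<Sigma> n)"
    and q: "0 \<le> q" "q < 1"
    and A1_class: "\<And>n. n \<ge> 1 \<Longrightarrow> \<Omega> n \<in> sparse_class (p n) q (s n) (M n)"
    and A1_rate: "(\<lambda>n. s n * M n powr (1 - 2 * q) / (n / ln (p n)) powr (1 / 2 - q / 2))
      \<longlonglongrightarrow> 0"
    and A4_dim: "(\<lambda>n. ln (p n) / n) \<longlonglongrightarrow> 0"
    and A4_K: "K > 0"
    and A4_moment: "\<And>n k i. k < n \<Longrightarrow> i < p n \<Longrightarrow>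
      integrable (P n) (\<lambda>\<omega>. (X n k i \<omega> - \<mu> n $ i) ^ 4) \<and>
      prob_space.expectation (P n) (\<lambda>\<omega>. (X n k i \<omega> - \<mu> n $ i) ^ 4) \<le> K"
    and mean_bounded: "\<And>n i. n \<ge> 1 \<Longrightarrow> i < p n \<Longrightarrow> \<bar>\<mu> n $ i\<bar> \<le> B"
    and K': "K' > 0"
  shows "\<exists>\<epsilon>0 :: nat \<Rightarrow> real. (\<forall>n. \<epsilon>0 n > 0) \<and>
    (\<forall>\<epsilon>. (\<forall>n. 0 < \<epsilon> n \<and> \<epsilon> n \<le> \<epsilon>0 n) \<longrightarrow>
      (\<forall>\<^sub>F C0 in at_top. \<exists>C1 C2 \<tau> A. \<tau> > 0 \<and>
        (\<forall>\<^sub>F n in sequentially. \<exists>E \<in> sets (P n).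
          measure (P n) E > 1 - A * real (p n) powr (- \<tau>) \<and>
          (\<forall>\<omega> \<in> E. \<forall>W.
            huber_scio n (p n) (K' * sqrt (n / ln (p n))) (\<epsilon> n)
              (C0 * M n * sqrt (ln (p n) / n)) (\<lambda>k i. X n k i \<omega>) W \<longrightarrow>
            max_norm (W - \<Omega> n) \<le> C1 * (M n)\<^sup>2 * sqrt (ln (p n) / n) \<and>
            L1_norm (W - \<Omega> n)
              \<le> C2 * s n * M n powr (2 - 2 * q) * (ln (p n) / n) powr (1 / 2 * (1 - q))))))"
proof -
  define v where "v = 1 + K + 8 * (K + B ^ 4)"
  define c where "c = K' * (3 + (v + 1) / K'\<^sup>2)"
  \<comment> \<open>The threshold \<open>1 / M n\<close> keeps the true covariance feasible. At
    \<open>n = 0\<close>, where nothing is known of \<open>M\<close>, any positive value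
    serves.\<close>
  define \<epsilon>0 where "\<epsilon>0 n = (if n \<ge> 1 then 1 / M n else 1)" for n
  have M0: "M n > 0" if "n \<ge> 1" for n
    by (rule sparse_class_bound_pos[OF A1_class[OF that] dim[OF that]])
  have pos: "\<forall>n. \<epsilon>0 n > 0" using M0 by (simp add: \<epsilon>0_def)
  have "1 \<le> p 1" by (rule dim) simp
  then have B0: "B \<ge> 0" using mean_bounded[of 1 0] by auto
  have "0 \<le> 8 * (K + B ^ 4)" using A4_K B0 by simp
  then have v0: "v > 0" using A4_K unfolding v_def by linarith
  have c0: "c > 0" using K' v0 by (simp add: c_def add_pos_pos)
  \<comment> \<open>Assumption \<open>A4_dim\<close> brings the deviation
    \<open>c * sqrt (ln (p n) / n)\<close> of the Huber roots below 1 eventually.\<close>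
  have "((\<lambda>n. sqrt (ln (p n) / n)) \<longlongrightarrow> sqrt 0) sequentially"
    by (intro tendsto_real_sqrt A4_dim)
  then have "((\<lambda>n. c * sqrt (ln (p n) / n)) \<longlongrightarrow> c * 0) sequentially"
    by (intro tendsto_mult tendsto_const) simp
  then have "\<forall>\<^sub>F n in sequentially. c * sqrt (ln (p n) / n) < 1"
    by (rule order_tendstoD) simp
  then have small: "\<forall>\<^sub>F n in sequentially. n \<ge> 1 \<and> c * sqrt (ln (p n) / n) < 1"
    using eventually_ge_at_top[of 1] by eventually_elim auto
  define good where "good \<epsilon> C0 C1 C2 \<tau> A n \<longleftrightarrow> (\<exists>E \<in> sets (P n).
      measure (P n) E > 1 - A * real (p n) powr (- \<tau>) \<and>
      (\<forall>\<omega> \<in> E. \<forall>W.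
        huber_scio n (p n) (K' * sqrt (n / ln (p n))) (\<epsilon> n)
          (C0 * M n * sqrt (ln (p n) / n)) (\<lambda>k i. X n k i \<omega>) W \<longrightarrow>
        max_norm (W - \<Omega> n) \<le> C1 * (M n)\<^sup>2 * sqrt (ln (p n) / n) \<and>
        L1_norm (W - \<Omega> n)
          \<le> C2 * s n * M n powr (2 - 2 * q) * (ln (p n) / n) powr (1 / 2 * (1 - q))))"
    for \<epsilon> C0 C1 C2 \<tau> A n
  \<comment> \<open>\<open>C1\<close> and \<open>C2\<close> come from inserting
    \<open>lam = C0 * M n * sqrt (ln (p n) / n)\<close> into the deterministic bounds.\<close>
  have bounds: "good \<epsilon> C0 (7 / 3 * C0) (5 * (7 / 3 * C0) powr (1 - q)) 1 5 n"
    if \<epsilon>: "\<forall>n. 0 < \<epsilon> n \<and> \<epsilon> n \<le> \<epsilon>0 n" and C0: "C0 \<ge> 6 * ((2 * B + 2) * c)"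
      and n: "n \<ge> 1" "c * sqrt (ln (p n) / n) < 1" for \<epsilon> C0 n
  proof (cases "p n = 1")
    case True
    txt \<open>Here \<open>ln (p n) = 0\<close> and the estimator is meaningless, but the empty event does,
      since \<open>1 - 5 < 0\<close>.\<close>
    then show ?thesis unfolding good_def by (intro bexI[of _ "{}"]) auto
  next
    case False
    interpret prob_space "P n" by (rule prob[OF n(1)])
    have p: "p n \<ge> 2" "p n \<ge> 1" using dim[OF n(1)] False by auto
    define a where "a = sqrt (ln (p n) / n)"
    have a: "a > 0" "real n * a\<^sup>2 = ln (p n)"
      using p n by (auto simp: a_def)
    have H: "K' * sqrt (n / ln (p n)) = K' / a"
      by (simp add: a_def real_sqrt_divide)
    have ca: "c * a \<le> 1" using n by (simp add: a_def)
    have C0p: "C0 > 0"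
      using C0 c0 B0 by (smt (verit) mult_pos_pos)
    have inv: "\<Sigma> n * \<Omega> n = 1\<^sub>m (p n)" "\<Omega> n * \<Sigma> n = 1\<^sub>m (p n)"
      using precision[OF n(1)] Sigma_dim[OF n(1)] A1_class[OF n(1)]
      by (auto simp: inverts_mat_def sparse_class_def sym_posdef_def)
    obtain E where E: "E \<in> events" "prob E \<ge> 1 - 4 / real (p n)"
      "\<And>x m S0 i j. x \<in> E \<Longrightarrow> huber_mean n (p n) (K' / a) (\<lambda>k i. X n k i x) m \<Longrightarrow>
        huber_cov n (p n) (K' / a) (\<lambda>k i. X n k i x) m S0 \<Longrightarrow> i < p n \<Longrightarrow> j < p n \<Longrightarrow>
        \<bar>S0 $$ (i, j) - \<Sigma> n $$ (i, j)\<bar> \<le> (2 * B + 2) * c * a"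
      using huber_cov_event[OF p(2) iid[OF n(1)] mean cov A4_moment mean_bounded[OF n(1)]
          less_imp_le[OF A4_K] K' a v_def c_def ca] by blast
    have "max_norm (W - \<Omega> n) \<le> 7 / 3 * C0 * (M n)\<^sup>2 * a \<and>
        L1_norm (W - \<Omega> n) \<le> 5 * (7 / 3 * C0) powr (1 - q) * s n * M n powr (2 - 2 * q) *
          (ln (p n) / n) powr (1 / 2 * (1 - q))"
      if "\<omega> \<in> E" and W: "huber_scio n (p n) (K' / a) (\<epsilon> n) (C0 * M n * a) (\<lambda>k i. X n k i \<omega>) W" for \<omega> W
    proof -
      obtain m S0 S L where est: "huber_mean n (p n) (K' / a) (\<lambda>k i. X n k i \<omega>) m"
          "huber_cov n (p n) (K' / a) (\<lambda>k i. X n k i \<omega>) m S0"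
          "psd_projection (p n) (\<epsilon> n) S0 S" "scio (p n) (C0 * M n * a) S L" "symmetrization (p n) L W"
        using W by (auto simp: huber_scio_def)
      define d where "d = (2 * B + 2) * c * a"
      have close: "\<bar>S $$ (i, j) - \<Sigma> n $$ (i, j)\<bar> \<le> 2 * d" if "i < p n" "j < p n" for i j
      proof (rule psd_projection_close[OF p(2) est(3) _ Sigma_dim[OF n(1)] _ _ that])
        show "S0 \<in> carrier_mat (p n) (p n)" using est(2) by (simp add: huber_cov_def)
        show "sym_possemidef (p n) (\<Sigma> n - \<epsilon> n \<cdot>\<^sub>m 1\<^sub>m (p n))"
        proof (rule covariance_feasible[OF p(2) Sigma_dim[OF n(1)] A1_class[OF n(1)] inv])
          show "\<epsilon> n \<le> 1 / M n" using spec[OF \<epsilon>, of n] n(1) by (simp add: \<epsilon>0_def)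
        qed
      qed (use E(3)[OF \<open>\<omega> \<in> E\<close> est(1,2)] in \<open>simp add: d_def\<close>)
      have S: "sym_possemidef (p n) S"
        using est(3) \<epsilon> by (intro sym_possemidef_shift[of S _ "\<epsilon> n"])
          (auto simp: psd_projection_def is_arg_min_def less_imp_le)
      \<comment> \<open>The projected error is \<open>2 * d\<close>, with
        \<open>d = (2 * B + 2) * c * a\<close>; asking for a third of the tuning parameter produces
        the factor 6 in the threshold for \<open>C0\<close>.\<close>
      have dM: "2 * d * M n \<le> C0 * M n * a / 3"
        using mult_right_mono[OF C0, of "M n * a"] M0[OF n(1)] a(1) by (simp add: d_def algebra_simps)
      have lam: "C0 * M n * a > 0" using C0p M0[OF n(1)] a(1) by simp
      note b = symmetrized_scio_bounds[OF p(2) Sigma_dim[OF n(1)] A1_class[OF n(1)] inv q M0[OF n(1)]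
          S close dM lam est(4,5)]
      have eq: "7 / 3 * M n * (C0 * M n * a) = 7 / 3 * C0 * (M n)\<^sup>2 * a"
        by (simp add: power2_eq_square)
      have rate: "(7 / 3 * C0 * (M n)\<^sup>2 * a) powr (1 - q) =
          (7 / 3 * C0) powr (1 - q) * M n powr (2 - 2 * q) * (ln (p n) / n) powr (1 / 2 * (1 - q))"
      proof -
        have "(x * y * z) powr r = x powr r * y powr r * z powr r"
          if "x \<ge> 0" "y \<ge> 0" "z \<ge> 0" for x y z r :: real
          using that by (simp add: powr_mult)
        from this[of "7 / 3 * C0" "(M n)\<^sup>2" a "1 - q"]
        have "(7 / 3 * C0 * (M n)\<^sup>2 * a) powr (1 - q) =
            (7 / 3 * C0) powr (1 - q) * (M n)\<^sup>2 powr (1 - q) * a powr (1 - q)"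
          using C0p a(1) by simp
        moreover have "(M n)\<^sup>2 = M n powr 2" using M0[OF n(1)] by simp
        moreover have "a = (ln (p n) / n) powr (1 / 2)"
          using p by (simp add: a_def powr_half_sqrt)
        ultimately show ?thesis by (simp add: powr_powr algebra_simps)
      qed
      show ?thesis using b unfolding eq rate by (simp add: mult_ac)
    qed
    \<comment> \<open>Taking 5 instead of 4 makes the inequality strict.\<close>
    moreover have "prob E > 1 - 5 * real (p n) powr (- 1)"
    proof -
      have "5 * real (p n) powr (- 1) = 5 / real (p n)"
        using p by (simp add: powr_minus_divide)
      moreover have "4 / real (p n) < 5 / real (p n)" using p by (intro divide_strict_right_mono) auto
      ultimately show ?thesis using E(2) by linarith
    qed
    ultimately show ?thesis
      using E(1) unfolding good_def H a_def[symmetric] by blast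
  qed
  show ?thesis
  proof (intro exI[of _ \<epsilon>0] conjI pos allI impI)
    fix \<epsilon> assume \<epsilon>: "\<forall>n. 0 < \<epsilon> n \<and> \<epsilon> n \<le> \<epsilon>0 n"
    have "\<forall>\<^sub>F C0 in at_top. \<exists>C1 C2 \<tau> A. \<tau> > 0 \<and> (\<forall>\<^sub>F n in sequentially. good \<epsilon> C0 C1 C2 \<tau> A n)"
      using eventually_ge_at_top[of "6 * ((2 * B + 2) * c)"]
    proof eventually_elim
      case (elim C0)
      show ?case
      proof (intro exI conjI)
        show "(0 :: real) < 1" by simp
        show "\<forall>\<^sub>F n in sequentially. good \<epsilon> C0 (7 / 3 * C0) (5 * (7 / 3 * C0) powr (1 - q)) 1 5 n"
          using small by eventually_elim (rule bounds[OF \<epsilon> elim]; simp)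
      qed
    qed
    then show "\<forall>\<^sub>F C0 in at_top. \<exists>C1 C2 \<tau> A. \<tau> > 0 \<and>
        (\<forall>\<^sub>F n in sequentially. \<exists>E \<in> sets (P n).
          measure (P n) E > 1 - A * real (p n) powr (- \<tau>) \<and>
          (\<forall>\<omega> \<in> E. \<forall>W.
            huber_scio n (p n) (K' * sqrt (n / ln (p n))) (\<epsilon> n)
              (C0 * M n * sqrt (ln (p n) / n)) (\<lambda>k i. X n k i \<omega>) W \<longrightarrow>
            max_norm (W - \<Omega> n) \<le> C1 * (M n)\<^sup>2 * sqrt (ln (p n) / n) \<and>
            L1_norm (W - \<Omega> n)
              \<le> C2 * s n * M n powr (2 - 2 * q) * (ln (p n) / n) powr (1 / 2 * (1 - q))))"
      unfolding good_def .
  qed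
qed

end
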